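(* Fix an arbitrary $\epsilon>0$. Let $P_n$ be a random school choice problem of size $n$. With probability tending to $1$ as $n\to\infty$, the envy digraph $G^{\mathrm{DA}(P_n)}$ has a strongly connected component containing at least $(1-\epsilon)n$ students (for $\epsilon<1/2$ this component is necessarily unique, and every other strongly connected component has at most $\epsilon n$ vertices).
   Context: A random school choice problem $P_n$ of size $n$ has a set $I$ of $n$ students and a set $S$ of $n$ schools, each with quota 1; each student's strict preference over $S$ and each school's strict priority over $I$ are uniformly random linear orders, all mutually independent. $\mathrm{DA}(P_n)$ is the matching produced by student-proposing deferred acceptance (each unheld student applies to her most preferred school not yet rejecting her; each school tentatively holds its highest-priority applicant and rejects the others; stop when no new rejection occurs). The envy digraph $G^{\mathrm{DA}(P_n)}$ has vertex set $I$ and a directed edge $(i,j)$ iff $i$ strictly prefers $\mathrm{DA}_j(P_n)$ to $\mathrm{DA}_i(P_n)$. A strongly connected component of a digraph is a maximal set of vertices such that each ordered pair of them is joined by a directed path. *)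

theory Defs
  imports "HOL-Combinatorics.Permutations" "HOL-Library.FuncSet" Complex_Main
begin

text \<open>Students and schools of a problem of size n are both {0..<n}.
A strict linear order on {0..<n} is represented by a permutation p of {0..<n}:
p r is the element of rank r (rank 0 = most preferred / highest priority).
pref i is student i's preference over schools, prio s is school s's priority
over students.\<close>

definition linorders :: "nat \<Rightarrow> (nat \<Rightarrow> nat) set" where
  "linorders n = {p. p permutes {0..<n}}"

text \<open>The finite, uniformly distributed sample space of school choice problems of size n.\<close>
definition problems :: "nat \<Rightarrow> ((nat \<Rightarrow> nat \<Rightarrow> nat) \<times> (nat \<Rightarrow> nat \<Rightarrow> nat)) set" where
  "problems n = ({0..<n} \<rightarrow>\<^sub>E linorders n) \<times> ({0..<n} \<rightarrow>\<^sub>E linorders n)"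

text \<open>State of deferred acceptance: k i = number of schools that have rejected student i;
student i currently applies to pref i (k i).  In each round every student with k i < n applies
to pref i (k i); each school holds its highest-priority applicant and rejects the others.\<close>

definition held :: "nat \<Rightarrow> (nat \<Rightarrow> nat \<Rightarrow> nat) \<Rightarrow> (nat \<Rightarrow> nat \<Rightarrow> nat) \<Rightarrow> (nat \<Rightarrow> nat) \<Rightarrow> nat \<Rightarrow> bool" where
  "held n pref prio k i \<longleftrightarrow>
     (\<forall>j<n. k j < n \<and> pref j (k j) = pref i (k i) \<longrightarrow>
        inv (prio (pref i (k i))) i \<le> inv (prio (pref i (k i))) j)"

definition da_step :: "nat \<Rightarrow> (nat \<Rightarrow> nat \<Rightarrow> nat) \<Rightarrow> (nat \<Rightarrow> nat \<Rightarrow> nat) \<Rightarrow> (nat \<Rightarrow> nat) \<Rightarrow> (nat \<Rightarrow> nat)" where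
  "da_step n pref prio k =
     (\<lambda>i. if i < n \<and> k i < n \<and> \<not> held n pref prio k i then Suc (k i) else k i)"

text \<open>Each round without rejection is a fixpoint; every round with a rejection increases
the total number of rejections, which is at most n*n, so n*n rounds reach termination.\<close>
definition da_rejections :: "nat \<Rightarrow> (nat \<Rightarrow> nat \<Rightarrow> nat) \<Rightarrow> (nat \<Rightarrow> nat \<Rightarrow> nat) \<Rightarrow> (nat \<Rightarrow> nat)" where
  "da_rejections n pref prio = (da_step n pref prio ^^ (n * n)) (\<lambda>_. 0)"

text \<open>DA_i(P): the school assigned to student i.\<close>
definition DA :: "nat \<Rightarrow> (nat \<Rightarrow> nat \<Rightarrow> nat) \<Rightarrow> (nat \<Rightarrow> nat \<Rightarrow> nat) \<Rightarrow> nat \<Rightarrow> nat" where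
  "DA n pref prio i = pref i (da_rejections n pref prio i)"

text \<open>Envy digraph of a matching mu: edge (i,j) iff i strictly prefers mu j to mu i.\<close>
definition envy_edges :: "nat \<Rightarrow> (nat \<Rightarrow> nat \<Rightarrow> nat) \<Rightarrow> (nat \<Rightarrow> nat) \<Rightarrow> (nat \<times> nat) set" where
  "envy_edges n pref mu =
     {(i, j). i < n \<and> j < n \<and> inv (pref i) (mu j) < inv (pref i) (mu i)}"

definition strongly_connected_set :: "nat set \<Rightarrow> (nat \<times> nat) set \<Rightarrow> nat set \<Rightarrow> bool" where
  "strongly_connected_set V E C \<longleftrightarrow> C \<subseteq> V \<and> (\<forall>i\<in>C. \<forall>j\<in>C. (i, j) \<in> E\<^sup>*)"

definition is_scc :: "nat set \<Rightarrow> (nat \<times> nat) set \<Rightarrow> nat set \<Rightarrow> bool" where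
  "is_scc V E C \<longleftrightarrow> C \<noteq> {} \<and> strongly_connected_set V E C \<and>
     (\<forall>D. C \<subseteq> D \<and> strongly_connected_set V E D \<longrightarrow> D = C)"

end

theory Submission
  imports Defs "HOL-Real_Asymp.Real_Asymp"
begin

text \<open>
If no strongly connected component is large, there is a set \<open>A\<close> of students, neither small nor almost
everything, that is closed under envy. Students in \<open>A\<close> who were rejected at least \<open>K\<close> times have all
their top \<open>K\<close> choices among the schools assigned to \<open>A\<close>. For a large constant \<open>K\<close> a union bound over
\<open>A\<close> and its schools excludes this, provided that all but few students are rejected at least \<open>K\<close> times.

The proviso is a first moment bound over all stable rejection profiles \<open>k\<close> (\<open>k i\<close> is the number of
schools rejecting student \<open>i\<close>), so that no deferred-decisions argument is needed. For a fixed profile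
and matching, stability has conditional probability \<open>\<Prod>\<^sub>s 1 / (1 + b\<^sub>s)\<close> given the preferences, where
\<open>b\<^sub>s\<close> counts the students rejected by \<open>s\<close>. Writing \<open>1 / (1 + b)\<close> as an average of powers \<open>y ^ b\<close> over
a grid in \<open>[0, 1]\<close> decouples the students; a Maclaurin type inequality then bounds each student's
contribution by \<open>(S / (n - 1)) ^ k i\<close> with \<open>S = \<Sum>\<^sub>s y\<^sub>s\<close>. Summing over profiles with \<open>\<Sum>\<^sub>i k i = m\<close>
yields, up to polynomial factors and a factor \<open>(n / (n - 1)) ^ m\<close>, the coupon collector probability
that \<open>m + n\<close> applications reach all schools. It is exponentially small for \<open>m \<le> C n\<close>; for larger \<open>m\<close>
requiring \<open>k i < K\<close> for linearly many students gains a large exponential factor.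
\<close>

subsection \<open>Averages over permutations and elementary estimates\<close>

text \<open>Composing with the transposition of \<open>a\<close> and \<open>b\<close> is an
  involution of \<open>P\<close> that leaves the other factors alone, so
  \<open>2 u v <= u^2 + v^2\<close> with \<open>u = y (p a)\<close>, \<open>v = y (p b)\<close>
  turns the mixed product into a square. This settles the case of a repeated position in the next
  lemma.\<close>

lemma symmetrized_product_le:
  fixes y :: "'b \<Rightarrow> real" and P :: "('a \<Rightarrow> 'b) set"
  assumes swap: "\<And>p. p \<in> P \<Longrightarrow> p \<circ> transpose a b \<in> P"
    and y: "\<And>s. y s \<ge> 0" and J: "finite J" "a \<in> J" "b \<notin> J"
  shows "(\<Sum>p\<in>P. (\<Prod>r\<in>insert b J. y (p r))) \<le> (\<Sum>p\<in>P. (\<Prod>r\<in>J. y (p r)) * y (p a))"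
proof -
  let ?\<tau> = "\<lambda>p. p \<circ> transpose a b"
  let ?Q = "\<lambda>p. (\<Prod>r\<in>J - {a}. y (p r))"
  have ab: "a \<noteq> b" using J by auto
  have inv: "?\<tau> (?\<tau> p) = p" for p :: "'a \<Rightarrow> 'b"
    by (simp add: comp_assoc)
  have bij: "bij_betw ?\<tau> P P"
    by (rule bij_betw_byWitness[where f' = ?\<tau>]) (use swap inv in auto)
  have Q: "?Q (?\<tau> p) = ?Q p" for p
    by (rule prod.cong) (use J in \<open>auto simp: transpose_def\<close>)
  have split: "(\<Prod>r\<in>J. y (p r)) = y (p a) * ?Q p" for p
    using J by (simp add: prod.remove)
  have eq: "(\<Sum>p\<in>P. ?Q p * (y (p b))\<^sup>2) = (\<Sum>p\<in>P. ?Q p * (y (p a))\<^sup>2)"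
  proof -
    have "(\<Sum>p\<in>P. ?Q p * (y (p a))\<^sup>2) = (\<Sum>p\<in>P. ?Q (?\<tau> p) * (y (?\<tau> p a))\<^sup>2)"
      by (rule sum.reindex_bij_betw[OF bij, symmetric])
    then show ?thesis by (simp only: Q) simp
  qed
  have "2 * (\<Sum>p\<in>P. (\<Prod>r\<in>insert b J. y (p r))) = (\<Sum>p\<in>P. ?Q p * (2 * y (p a) * y (p b)))"
    using J by (simp add: split sum_distrib_left mult_ac)
  also have "\<dots> \<le> (\<Sum>p\<in>P. ?Q p * ((y (p a))\<^sup>2 + (y (p b))\<^sup>2))"
    by (intro sum_mono mult_left_mono prod_nonneg) (use y sum_squares_bound in \<open>auto\<close>)
  also have "\<dots> = 2 * (\<Sum>p\<in>P. ?Q p * (y (p a))\<^sup>2)"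
    by (simp add: distrib_left sum.distrib eq)
  also have "\<dots> = 2 * (\<Sum>p\<in>P. (\<Prod>r\<in>J. y (p r)) * y (p a))"
    by (simp add: split power2_eq_square mult_ac)
  finally show ?thesis by simp
qed

text \<open>Maclaurin's inequality for elementary symmetric means, as an average over
  \<open>P\<close>. \<open>D\<close> is the set of exchangeable positions; it can omit a position
  whose value is prescribed. Induction on \<open>k\<close>: the next factor is replaced by
  \<open>y (p t)\<close> for every \<open>t\<close> in \<open>D\<close>, and summing over
  \<open>t\<close> produces \<open>S\<close>.\<close>

lemma maclaurin_symmetric_family:
  fixes y :: "'b \<Rightarrow> real" and P :: "(nat \<Rightarrow> 'b) set"
  assumes P: "finite P" "finite D"
    and swap: "\<And>p a b. p \<in> P \<Longrightarrow> a \<in> D \<Longrightarrow> b \<in> D \<Longrightarrow> p \<circ> transpose a b \<in> P"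
    and y: "\<And>s. y s \<ge> 0" and S: "\<And>p. p \<in> P \<Longrightarrow> (\<Sum>t\<in>D. y (p t)) \<le> S"
    and S0: "S \<ge> 0"
    and k: "{..<k} \<subseteq> D"
  shows "real (card D) ^ k * (\<Sum>p\<in>P. \<Prod>r<k. y (p r)) \<le> S ^ k * real (card P)"
  using k
proof (induction k)
  case 0
  then show ?case by simp
next
  case (Suc k)
  let ?H = "\<lambda>k. \<Sum>p\<in>P. \<Prod>r<k. y (p r)"
  have kD: "k \<in> D" "{..<k} \<subseteq> D" using Suc.prems by (auto simp: lessThan_Suc)
  \<comment> \<open>For \<open>t < k\<close> the factor at \<open>t\<close> becomes a square, by the
    preceding lemma; otherwise exchanging \<open>t\<close> and \<open>k\<close> gives
    equality.\<close>
  have each: "?H (Suc k) \<le> (\<Sum>p\<in>P. (\<Prod>r<k. y (p r)) * y (p t))" if t: "t \<in> D" for t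
  proof (cases "t < k")
    case True
    have "(\<Sum>p\<in>P. \<Prod>r\<in>insert k {..<k}. y (p r)) \<le> (\<Sum>p\<in>P. (\<Prod>r<k. y (p r)) * y (p t))"
      by (rule symmetrized_product_le) (use True t kD swap y in auto)
    then show ?thesis by (simp add: lessThan_Suc)
  next
    case False
    let ?\<tau> = "\<lambda>p. p \<circ> transpose t k"
    have "bij_betw ?\<tau> P P"
      by (rule bij_betw_byWitness[where f' = ?\<tau>]) (use swap t kD in \<open>auto simp: comp_assoc\<close>)
    then have "?H (Suc k) = (\<Sum>p\<in>P. \<Prod>r<Suc k. y (?\<tau> p r))"
      by (rule sum.reindex_bij_betw[symmetric])
    also have "\<dots> = (\<Sum>p\<in>P. (\<Prod>r<k. y (p r)) * y (p t))"
    proof (rule sum.cong[OF refl])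
      fix p
      have "(\<Prod>r<k. y (?\<tau> p r)) = (\<Prod>r<k. y (p r))"
        by (rule prod.cong) (use False in \<open>auto simp: transpose_def\<close>)
      then show "(\<Prod>r<Suc k. y (?\<tau> p r)) = (\<Prod>r<k. y (p r)) * y (p t)" by simp
    qed
    finally show ?thesis by simp
  qed
  have "real (card D) * ?H (Suc k) = (\<Sum>t\<in>D. ?H (Suc k))" by simp
  also have "\<dots> \<le> (\<Sum>t\<in>D. \<Sum>p\<in>P. (\<Prod>r<k. y (p r)) * y (p t))"
    by (intro sum_mono each)
  also have "\<dots> = (\<Sum>p\<in>P. (\<Prod>r<k. y (p r)) * (\<Sum>t\<in>D. y (p t)))"
    by (subst sum.swap) (simp add: sum_distrib_left)
  also have "\<dots> \<le> (\<Sum>p\<in>P. (\<Prod>r<k. y (p r)) * S)"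
    by (intro sum_mono mult_left_mono S prod_nonneg) (use y in auto)
  also have "\<dots> = S * ?H k" by (simp add: sum_distrib_left mult_ac)
  finally have step: "real (card D) * ?H (Suc k) \<le> S * ?H k" .
  have "real (card D) ^ Suc k * ?H (Suc k) = real (card D) ^ k * (real (card D) * ?H (Suc k))"
    by simp
  also have "\<dots> \<le> real (card D) ^ k * (S * ?H k)"
    by (intro mult_left_mono step) auto
  also have "\<dots> = S * (real (card D) ^ k * ?H k)" by simp
  also have "\<dots> \<le> S * (S ^ k * real (card P))"
    using Suc.IH kD(2) S0 by (intro mult_left_mono) auto
  finally show ?case by simp
qed

section \<open>Counting linear orders by symmetry\<close>

text \<open>Each of the disjoint sets contains an injective copy of \<open>F m\<close>. This turns
  exchange symmetries into upper bounds on probabilities without exact counting.\<close>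

lemma card_times_card_disjoint_family_le:
  assumes A: "finite A" and U: "finite U" and m: "m \<in> A"
    and F: "\<And>a. a \<in> A \<Longrightarrow> F a \<subseteq> U"
    and disj: "\<And>a b. a \<in> A \<Longrightarrow> b \<in> A \<Longrightarrow> a \<noteq> b \<Longrightarrow> F a \<inter> F b = {}"
    and h: "\<And>a. a \<in> A \<Longrightarrow> inj_on (h a) (F m)" "\<And>a p. a \<in> A \<Longrightarrow> p \<in> F m \<Longrightarrow> h a p \<in> F a"
  shows "card A * card (F m) \<le> card U"
proof -
  have fin: "finite (F a)" if "a \<in> A" for a using F U that by (meson finite_subset)
  have "card A * card (F m) = (\<Sum>a\<in>A. card (F m))" by simp
  also have "\<dots> \<le> (\<Sum>a\<in>A. card (F a))"
    by (intro sum_mono card_inj_on_le[of "h a" for a]) (use h fin in auto)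
  also have "\<dots> = card (\<Union>a\<in>A. F a)"
    by (rule card_UN_disjoint[symmetric]) (use A fin disj in auto)
  also have "\<dots> \<le> card U"
    by (intro card_mono U) (use F in auto)
  finally show ?thesis .
qed

lemma finite_linorders [simp]: "finite (linorders n)"
  by (simp add: linorders_def finite_permutations)

lemma card_linorders: "card (linorders n) = fact n"
  by (simp add: linorders_def card_permutations)

lemma transpose_comp_linorders:
  "p \<in> linorders n \<Longrightarrow> a < n \<Longrightarrow> b < n \<Longrightarrow> transpose a b \<circ> p \<in> linorders n"
  by (auto simp: linorders_def intro!: permutes_compose permutes_swap_id)

lemma comp_transpose_linorders:
  "p \<in> linorders n \<Longrightarrow> a < n \<Longrightarrow> b < n \<Longrightarrow> p \<circ> transpose a b \<in> linorders n"
  by (auto simp: linorders_def intro!: permutes_compose permutes_swap_id)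

lemma inj_transpose_comp: "inj_on (\<lambda>p. transpose a b \<circ> p) X"
  by (rule inj_on_inverseI[where g = "\<lambda>p. transpose a b \<circ> p"]) (simp add: comp_assoc[symmetric])

lemma card_linorders_fixed_value:
  assumes "a < n" "m < n"
  shows "n * card {p \<in> linorders n. p a = m} \<le> fact n"
proof -
  have "card {0..<n} * card {p \<in> linorders n. p a = m} \<le> card (linorders n)"
    by (rule card_times_card_disjoint_family_le[where F = "\<lambda>m. {p \<in> linorders n. p a = m}"
          and h = "\<lambda>m' p. transpose m m' \<circ> p" and m = m])
      (use assms in \<open>auto intro: transpose_comp_linorders inj_transpose_comp\<close>)
  then show ?thesis by (simp add: card_linorders)
qed

text \<open>The events that a given member of \<open>insert m A\<close> comes first are disjoint,
  and exchanging \<open>m\<close> with \<open>a\<close> carries one into another. With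
  \<open>A\<close> the students rejected by a school and \<open>m\<close> its partner, this is the
  factor \<open>1 / (1 + b)\<close> of stability at that school.\<close>

lemma card_linorders_best:
  assumes A: "A \<subseteq> {0..<n}" and m: "m < n" "m \<notin> A"
  shows "(card A + 1) * card {p \<in> linorders n. \<forall>a\<in>A. inv p m \<le> inv p a} \<le> fact n"
proof -
  let ?G = "\<lambda>c. {p \<in> linorders n. \<forall>a\<in>insert m A. inv p c \<le> inv p a}"
  have fin: "finite A" using A finite_subset by blast
  have inj: "inv p a = inv p b \<Longrightarrow> a = b" if "p \<in> linorders n" for p a b
    using that permutes_inverses(1) unfolding linorders_def by (metis mem_Collect_eq)
  have "card (insert m A) * card (?G m) \<le> card (linorders n)"
  proof (rule card_times_card_disjoint_family_le[where F = ?G and h = "\<lambda>m' p. transpose m m' \<circ> p"])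
    show "inj_on (\<lambda>p. transpose m a \<circ> p) (?G m)" for a
      by (rule inj_transpose_comp)
    show "?G a \<inter> ?G b = {}" if "a \<in> insert m A" "b \<in> insert m A" "a \<noteq> b" for a b
    proof (rule ccontr)
      assume "?G a \<inter> ?G b \<noteq> {}"
      then obtain p where "p \<in> ?G a" "p \<in> ?G b" by auto
      then have "p \<in> linorders n" "inv p a = inv p b"
        using that(1,2) by (auto intro: le_antisym)
      then show False using inj that(3) by blast
    qed
    show "transpose m a \<circ> p \<in> ?G a" if a: "a \<in> insert m A" and p: "p \<in> ?G m" for a p
    proof -
      have "a < n" using a A m by auto
      have pp: "p permutes {0..<n}" using p by (auto simp: linorders_def)
      have "inv (transpose m a \<circ> p) = inv p \<circ> transpose m a"
        using o_inv_distrib[OF bij_transpose permutes_bij[OF pp]] by simp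
      moreover have "inv p m \<le> inv p (transpose m a c)" if "c \<in> insert m A" for c
        using that a p by (auto simp: transpose_def)
      ultimately show ?thesis
        using p transpose_comp_linorders[of p n m a] \<open>a < n\<close> m(1) a by auto
    qed
  qed (use fin in auto)
  moreover have "?G m = {p \<in> linorders n. \<forall>a\<in>A. inv p m \<le> inv p a}" by auto
  ultimately show ?thesis using fin m by (simp add: card_linorders)
qed

section \<open>Riemann sums and a Stirling bound\<close>

text \<open>The left side is the integral of \<open>y ^ b\<close> over \<open>[0, 1]\<close>, and
  the sum takes right endpoints of a nondecreasing function. A finite grid keeps all later exchanges
  of sums and products finite.\<close>

lemma inverse_Suc_le_riemann_sum:
  assumes "N > 0"
  shows "1 / (1 + real b) \<le> (\<Sum>j\<in>{1..N}. (real j / real N) ^ b) / real N"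
proof -
  \<comment> \<open>With denominators cleared the bound telescopes: the increment
    \<open>(N + 1) ^ (b + 1) - N ^ (b + 1)\<close> is at most
    \<open>(b + 1) * (N + 1) ^ b\<close>.\<close>
  have "real N ^ Suc b \<le> (1 + real b) * (\<Sum>j\<in>{1..N}. real j ^ b)" for N
  proof (induction N)
    case (Suc N)
    have "real (Suc N) ^ Suc b - real N ^ Suc b
        = (real (Suc N) - real N) * (\<Sum>i<Suc b. real N ^ (b - i) * real (Suc N) ^ i)"
      by (subst diff_power_eq_sum) (simp only: mult.commute)
    also have "\<dots> = (\<Sum>i<Suc b. real N ^ (b - i) * real (Suc N) ^ i)" by simp
    also have "\<dots> \<le> (\<Sum>i<Suc b. real (Suc N) ^ b)"
    proof (rule sum_mono)
      fix i assume "i \<in> {..<Suc b}"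
      then have "real (Suc N) ^ b = real (Suc N) ^ (b - i) * real (Suc N) ^ i"
        by (simp add: power_add[symmetric] del: of_nat_Suc)
      moreover have "real N ^ (b - i) \<le> real (Suc N) ^ (b - i)" by (intro power_mono) auto
      ultimately show "real N ^ (b - i) * real (Suc N) ^ i \<le> real (Suc N) ^ b"
        by (simp add: mult_right_mono del: of_nat_Suc)
    qed
    finally have "real (Suc N) ^ Suc b - real N ^ Suc b \<le> (1 + real b) * real (Suc N) ^ b" by simp
    then show ?case using Suc.IH by (simp add: distrib_left del: power_Suc of_nat_Suc)
  qed simp
  from this[of N] show ?thesis
    using assms by (simp add: power_divide sum_divide_distrib[symmetric] field_simps)
qed

text \<open>A geometric sum with ratio \<open>q = exp (x / N)\<close>, where
  \<open>q - 1 >= x / N\<close>. The factor \<open>exp (x / N)\<close> is the price of right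
  endpoints over the integral \<open>(exp x - 1) / x\<close>.\<close>

lemma exp_riemann_sum_le:
  fixes x :: real
  assumes "N > 0" "x > 0"
  shows "(\<Sum>j\<in>{1..N}. exp (x * (real j / real N))) / real N \<le> exp (x / real N) * (exp x - 1) / x"
proof -
  define q where "q = exp (x / real N)"
  have q: "q - 1 \<ge> x / real N" "x / real N > 0"
    using assms exp_ge_add_one_self[of "x / real N"] by (auto simp: q_def simp del: exp_ge_add_one_self)
  have qN: "q ^ N = exp x" using assms by (simp add: q_def exp_of_nat_mult[symmetric])
  have "(\<Sum>j\<in>{1..N}. exp (x * (real j / real N))) = (\<Sum>j\<in>{1..N}. q ^ j)"
    by (rule sum.cong) (auto simp: q_def exp_of_nat_mult[symmetric] mult_ac)
  also have "\<dots> = q * (\<Sum>j<N. q ^ j)"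
    by (simp add: sum_distrib_left sum.atLeast1_atMost_eq lessThan_atLeast0)
  also have "\<dots> = q * ((exp x - 1) / (q - 1))"
    using q by (subst geometric_sum) (auto simp: qN)
  also have "\<dots> \<le> q * ((exp x - 1) / (x / real N))"
    using q assms by (intro mult_left_mono divide_left_mono) (auto simp: q_def)
  finally show ?thesis using assms by (simp add: q_def field_simps)
qed

text \<open>Stirling's upper bound up to a linear factor; \<open>n + 1\<close> in place of
  \<open>n\<close> makes it valid at \<open>n = 0\<close>.\<close>

lemma fact_exp_le: "fact n * exp (real n) \<le> exp 1 * (real n + 1) * real n ^ n"
proof (cases "n = 0")
  case False
  have "fact (Suc n) * exp (real (Suc n)) \<le> exp 1 * real (Suc n) * real (Suc n) ^ Suc n" for n
  proof (induction n)
    case (Suc n)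
    let ?m = "Suc n"
    \<comment> \<open>The induction step amounts to \<open>exp 1 <= (1 + 1 / m) ^ (m + 1)\<close>,
      which comes from \<open>ln z <= z - 1\<close> at \<open>z = m / (m + 1)\<close>.\<close>
    have "1 / real (Suc ?m) \<le> ln (1 + 1 / real ?m)"
    proof -
      have "ln (real ?m / real (Suc ?m)) \<le> real ?m / real (Suc ?m) - 1"
        by (intro ln_le_minus_one) auto
      also have "\<dots> = - (1 / real (Suc ?m))" by (simp add: field_simps)
      finally have "1 / real (Suc ?m) \<le> - ln (real ?m / real (Suc ?m))" by simp
      also have "\<dots> = ln (real (Suc ?m) / real ?m)"
        by (simp add: ln_div del: of_nat_Suc)
      also have "real (Suc ?m) / real ?m = 1 + 1 / real ?m" by (simp add: field_simps)
      finally show ?thesis .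
    qed
    then have "1 \<le> real (Suc ?m) * ln (1 + 1 / real ?m)"
      by (simp add: field_simps del: of_nat_Suc)
    then have "exp 1 \<le> exp (real (Suc ?m) * ln (1 + 1 / real ?m))" by simp
    also have "\<dots> = (1 + 1 / real ?m) ^ Suc ?m"
      by (subst exp_of_nat_mult) (simp add: add_pos_nonneg)
    also have "1 + 1 / real ?m = real (Suc ?m) / real ?m" by (simp add: field_simps)
    finally have *: "exp 1 * real ?m ^ Suc ?m \<le> real (Suc ?m) ^ Suc ?m"
      by (simp add: power_divide pos_le_divide_eq del: power_Suc of_nat_Suc)
    have "fact (Suc ?m) * exp (real (Suc ?m)) = (real (Suc ?m) * exp 1) * (fact ?m * exp (real ?m))"
      unfolding fact_Suc[of ?m] of_nat_Suc[of ?m] exp_add by (simp only: mult_ac of_nat_Suc)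
    also have "\<dots> \<le> (real (Suc ?m) * exp 1) * (exp 1 * real ?m * real ?m ^ ?m)"
      by (intro mult_left_mono Suc.IH) auto
    also have "\<dots> = exp 1 * real (Suc ?m) * (exp 1 * real ?m ^ Suc ?m)"
      by (simp only: power_Suc mult_ac)
    also have "\<dots> \<le> exp 1 * real (Suc ?m) * real (Suc ?m) ^ Suc ?m"
      by (intro mult_left_mono *) auto
    finally show ?case .
  qed simp
  from this[of "n - 1"] have "fact n * exp (real n) \<le> exp 1 * real n * real n ^ n"
    using False by simp
  also have "\<dots> \<le> exp 1 * (real n + 1) * real n ^ n"
    by (intro mult_right_mono mult_left_mono) auto
  finally show ?thesis .
qed simp

subsection \<open>Deferred acceptance and the envy digraph\<close>

text \<open>Stability without reference to the algorithm, so that a union bound over all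
  \<open>k\<close> is possible. Ranks start at 0: \<open>k i\<close> is both the rank of the school
  assigned to \<open>i\<close> and the number of schools she prefers to it. The last clause excludes
  blocking pairs.\<close>

definition stable_profile ::
    "nat \<Rightarrow> (nat \<Rightarrow> nat \<Rightarrow> nat) \<Rightarrow> (nat \<Rightarrow> nat \<Rightarrow> nat) \<Rightarrow> (nat \<Rightarrow> nat) \<Rightarrow> bool" where
  "stable_profile n pref prio k \<longleftrightarrow>
     (\<forall>i<n. k i < n) \<and> inj_on (\<lambda>i. pref i (k i)) {0..<n} \<and>
     (\<forall>i<n. \<forall>r<k i. \<forall>j<n. pref j (k j) = pref i r \<longrightarrow>
        inv (prio (pref i r)) j \<le> inv (prio (pref i r)) i)"

text \<open>The part of stability that holds in every round. \<open>k i = n\<close> marks an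
  exhausted student, who applies nowhere, and a school may still have several applicants.\<close>

definition da_invariant ::
    "nat \<Rightarrow> (nat \<Rightarrow> nat \<Rightarrow> nat) \<Rightarrow> (nat \<Rightarrow> nat \<Rightarrow> nat) \<Rightarrow> (nat \<Rightarrow> nat) \<Rightarrow> bool" where
  "da_invariant n pref prio k \<longleftrightarrow>
     (\<forall>i<n. k i \<le> n) \<and>
     (\<forall>i<n. \<forall>r<k i. \<exists>j<n. k j < n \<and> pref j (k j) = pref i r \<and>
        inv (prio (pref i r)) j \<le> inv (prio (pref i r)) i)"

lemma held_applicant_exists:
  assumes "i < n" "k i < n"
  obtains j where "j < n" "k j < n" "pref j (k j) = pref i (k i)" "held n pref prio k j"
    "inv (prio (pref i (k i))) j \<le> inv (prio (pref i (k i))) i"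
proof -
  let ?s = "pref i (k i)"
  let ?A = "\<lambda>j. j < n \<and> k j < n \<and> pref j (k j) = ?s"
  obtain j where j: "?A j" "\<And>j'. ?A j' \<Longrightarrow> inv (prio ?s) j \<le> inv (prio ?s) j'"
    using arg_min_nat_lemma[of ?A i "inv (prio ?s)"] assms by blast
  show ?thesis
    by (rule that[of j]) (use j assms in \<open>auto simp: held_def\<close>)
qed

lemma da_invariant_step:
  assumes inv: "da_invariant n pref prio k"
  shows "da_invariant n pref prio (da_step n pref prio k)"
proof -
  let ?k = "da_step n pref prio k"
  \<comment> \<open>A school's best applicant is held and so stays there in the next round; this is
    the new witness.\<close>
  have keep: "\<exists>j<n. ?k j < n \<and> pref j (?k j) = pref i r \<and>
      inv (prio (pref i r)) j \<le> inv (prio (pref i r)) i"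
    if "i < n" and ex: "\<exists>j<n. k j < n \<and> pref j (k j) = pref i r \<and>
      inv (prio (pref i r)) j \<le> inv (prio (pref i r)) i" for i r
  proof -
    obtain j where j: "j < n" "k j < n" "pref j (k j) = pref i r"
      "inv (prio (pref i r)) j \<le> inv (prio (pref i r)) i" using ex by blast
    obtain l where l: "l < n" "k l < n" "pref l (k l) = pref j (k j)" "held n pref prio k l"
      "inv (prio (pref j (k j))) l \<le> inv (prio (pref j (k j))) j"
      using held_applicant_exists[of j n k pref prio] j by metis
    have "?k l = k l" using l by (simp add: da_step_def)
    then show ?thesis using l j by (intro exI[of _ l]) auto
  qed
  have "\<exists>j<n. k j < n \<and> pref j (k j) = pref i r \<and>
      inv (prio (pref i r)) j \<le> inv (prio (pref i r)) i" if i: "i < n" and r: "r < ?k i" for i r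
  proof (cases "r < k i")
    case True
    then show ?thesis using inv i by (auto simp: da_invariant_def)
  next
    case False
    then have "r = k i" "k i < n" using r by (auto simp: da_step_def split: if_splits)
    \<comment> \<open>For the rejection of this very round, \<open>i\<close> herself is an applicant
      at the school before it; \<open>keep\<close> carries this past the round.\<close>
    then show ?thesis using i by (intro exI[of _ i]) auto
  qed
  then have "\<forall>i<n. \<forall>r<?k i. \<exists>j<n. ?k j < n \<and> pref j (?k j) = pref i r \<and>
      inv (prio (pref i r)) j \<le> inv (prio (pref i r)) i"
    using keep by blast
  moreover have "\<forall>i<n. ?k i \<le> n" using inv by (auto simp: da_step_def da_invariant_def)
  ultimately show ?thesis by (simp add: da_invariant_def)
qed

lemma da_invariant_iterate: "da_invariant n pref prio ((da_step n pref prio ^^ t) (\<lambda>_. 0))"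
  by (induction t) (auto simp: da_invariant_step, simp add: da_invariant_def)

lemma da_fixpoint_or_progress:
  "da_step n pref prio ((da_step n pref prio ^^ t) (\<lambda>_. 0)) = (da_step n pref prio ^^ t) (\<lambda>_. 0)
    \<or> t \<le> (\<Sum>i<n. (da_step n pref prio ^^ t) (\<lambda>_. 0) i)"
proof (induction t)
  case (Suc t)
  let ?k = "(da_step n pref prio ^^ t) (\<lambda>_. 0)"
  let ?k' = "da_step n pref prio ?k"
  show ?case
  proof (cases "?k' = ?k")
    case False
    then have t: "t \<le> (\<Sum>i<n. ?k i)" using Suc by simp
    from False obtain i where i: "?k' i \<noteq> ?k i" by blast
    then have "i < n" by (auto simp: da_step_def split: if_splits)
    have "(\<Sum>i<n. ?k i) < (\<Sum>i<n. ?k' i)"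
    proof (rule sum_strict_mono_ex1)
      show "\<exists>i\<in>{..<n}. ?k i < ?k' i"
        using i \<open>i < n\<close> by (intro bexI[of _ i]) (auto simp: da_step_def split: if_splits)
    qed (auto simp: da_step_def)
    with t show ?thesis by simp
  qed simp
qed simp

text \<open>Without a fixpoint after \<open>n * n\<close> rounds there would be at least
  \<open>n * n\<close> rejections, although no student has more than \<open>n\<close> and some
  student still has fewer.\<close>

lemma da_rejections_fixpoint:
  "da_step n pref prio (da_rejections n pref prio) = da_rejections n pref prio"
proof (rule ccontr)
  let ?k = "da_rejections n pref prio"
  assume neq: "da_step n pref prio ?k \<noteq> ?k"
  then have ge: "n * n \<le> (\<Sum>i<n. ?k i)"
    using da_fixpoint_or_progress[of n pref prio "n * n"] by (simp add: da_rejections_def)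
  have le: "?k i \<le> n" if "i < n" for i
    using da_invariant_iterate[of n pref prio "n * n"] that
    by (simp add: da_rejections_def da_invariant_def)
  from neq obtain i where i: "da_step n pref prio ?k i \<noteq> ?k i" by blast
  then have "i < n" "?k i < n" by (auto simp: da_step_def split: if_splits)
  then have "(\<Sum>i<n. ?k i) < (\<Sum>i<n. n)"
    by (intro sum_strict_mono_ex1) (use le in auto)
  with ge show False by simp
qed

lemma da_rejections_stable:
  assumes P: "(pref, prio) \<in> problems n"
  shows "stable_profile n pref prio (da_rejections n pref prio)"
proof -
  define k where "k = da_rejections n pref prio"
  have pref: "pref i permutes {0..<n}" and prio: "prio i permutes {0..<n}" if "i < n" for i
    using P that by (auto simp: problems_def linorders_def PiE_iff)
  have inv: "da_invariant n pref prio k"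
    unfolding k_def da_rejections_def by (rule da_invariant_iterate)
  have held: "held n pref prio k i" if "i < n" "k i < n" for i
    using fun_cong[OF da_rejections_fixpoint[of n pref prio], of i] that
    by (auto simp: da_step_def k_def split: if_splits)
  have inj: "i = j" if i: "i < n" "k i < n" and j: "j < n" "k j < n"
    and eq: "pref i (k i) = pref j (k j)" for i j
  proof -
    let ?s = "pref i (k i)"
    have s: "?s < n" using pref[OF i(1)] i permutes_in_image[of "pref i" "{0..<n}" "k i"] by simp
    have "inv (prio ?s) i \<le> inv (prio ?s) j" "inv (prio ?s) j \<le> inv (prio ?s) i"
      using held[OF i] held[OF j] i j eq by (auto simp: held_def)
    then have "inv (prio ?s) i = inv (prio ?s) j" by simp
    then show ?thesis using permutes_inverses(1)[OF prio[OF s]] by metis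
  qed
  \<comment> \<open>Pigeonhole: an exhausted student was rejected by all \<open>n\<close> schools,
    each of which has a current applicant other than her, but only \<open>n - 1\<close> other
    students exist.\<close>
  have lt: "k i < n" if i: "i < n" for i
  proof (rule ccontr)
    assume "\<not> k i < n"
    then have ki: "k i = n" using inv i by (auto simp: da_invariant_def intro: le_antisym)
    have "{0..<n} \<subseteq> (\<lambda>j. pref j (k j)) ` ({0..<n} - {i})"
    proof
      fix s assume "s \<in> {0..<n}"
      then obtain r where r: "r < n" "s = pref i r"
        using permutes_image[OF pref[OF i]] by (metis atLeastLessThan_iff imageE)
      then obtain j where "j < n" "k j < n" "pref j (k j) = s"
        using inv i ki unfolding da_invariant_def by blast
      moreover have "j \<noteq> i" using \<open>k j < n\<close> ki by auto
      ultimately show "s \<in> (\<lambda>j. pref j (k j)) ` ({0..<n} - {i})" by force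
    qed
    then have "card {0..<n} \<le> card ({0..<n} - {i})"
      by (meson finite_Diff finite_atLeastLessThan surj_card_le)
    then show False using i by simp
  qed
  have "stable_profile n pref prio k"
    unfolding stable_profile_def
  proof (intro conjI allI impI)
    show "inj_on (\<lambda>i. pref i (k i)) {0..<n}" using inj lt by (auto simp: inj_on_def)
    show "inv (prio (pref i r)) j \<le> inv (prio (pref i r)) i"
      if ij: "i < n" "r < k i" "j < n" "pref j (k j) = pref i r" for i r j
    proof -
      obtain j' where "j' < n" "pref j' (k j') = pref i r"
        "inv (prio (pref i r)) j' \<le> inv (prio (pref i r)) i"
        using inv ij(1,2) unfolding da_invariant_def by blast
      moreover have "j' = j" using inj lt ij calculation by simp
      ultimately show ?thesis by simp
    qed
  qed (use lt in auto)
  then show ?thesis by (simp add: k_def)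
qed

lemma stable_profile_bij:
  assumes "(pref, prio) \<in> problems n" "stable_profile n pref prio k"
  shows "bij_betw (\<lambda>i. pref i (k i)) {0..<n} {0..<n}"
proof -
  have "pref i (k i) \<in> {0..<n}" if "i < n" for i
  proof -
    have "pref i permutes {0..<n}" "k i < n" using assms that
      by (auto simp: problems_def linorders_def PiE_iff stable_profile_def)
    then show ?thesis using permutes_in_image[of "pref i" "{0..<n}" "k i"] by simp
  qed
  then have "(\<lambda>i. pref i (k i)) ` {0..<n} \<subseteq> {0..<n}" by auto
  moreover have "inj_on (\<lambda>i. pref i (k i)) {0..<n}" using assms by (simp add: stable_profile_def)
  ultimately show ?thesis by (simp add: bij_betw_def endo_inj_surj)
qed

section \<open>Closed sets and strongly connected components\<close>

lemma is_scc_component: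
  assumes E: "E \<subseteq> V \<times> V" and v: "v \<in> V"
  shows "is_scc V E {w. (v, w) \<in> E\<^sup>* \<and> (w, v) \<in> E\<^sup>*}"
proof -
  let ?C = "{w. (v, w) \<in> E\<^sup>* \<and> (w, v) \<in> E\<^sup>*}"
  have "w \<in> V" if "(v, w) \<in> E\<^sup>*" for w
    using that by (induction rule: rtrancl_induct) (use E v in auto)
  then have "strongly_connected_set V E ?C"
    by (auto simp: strongly_connected_set_def intro: rtrancl_trans)
  moreover have "D = ?C" if "?C \<subseteq> D" "strongly_connected_set V E D" for D
    using that by (auto simp: strongly_connected_set_def)
  ultimately show ?thesis unfolding is_scc_def by auto
qed

text \<open>If no closed set has intermediate size, the largest small closed set and the smallest
  large closed set differ by a strongly connected set.\<close>

lemma large_scc_or_medium_closed_set: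
  fixes \<delta> :: real
  assumes V: "finite V" "V \<noteq> {}" and E: "E \<subseteq> V \<times> V" and \<delta>: "0 < \<delta>" "3 * \<delta> \<le> 1"
  obtains (scc) C where "is_scc V E C" "real (card C) \<ge> (1 - 2 * \<delta>) * card V"
  | (closed) A where "A \<subseteq> V" "E `` A \<subseteq> A" "\<delta> * card V \<le> card A" "card A \<le> (1 - \<delta>) * card V"
proof (cases "\<exists>A. A \<subseteq> V \<and> E `` A \<subseteq> A \<and> \<delta> * card V \<le> card A \<and> card A \<le> (1 - \<delta>) * card V")
  case False
  let ?n = "real (card V)"
  let ?cl = "\<lambda>A. A \<subseteq> V \<and> E `` A \<subseteq> A"
  let ?small = "\<lambda>A. ?cl A \<and> card A < \<delta> * ?n" and ?large = "\<lambda>A. ?cl A \<and> card A > (1 - \<delta>) * ?n"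
  have dich: "?small A \<or> ?large A" if "?cl A" for A
    using False that by (meson not_le)
  have n: "?n > 0" using V by (simp add: card_gt_0_iff)
  have dn: "3 * \<delta> * ?n \<le> ?n" using \<delta> n by (simp add: mult_le_cancel_right1)
  have fin: "finite A" if "A \<subseteq> V" for A using that V finite_subset by blast
  have bd: "card A \<le> card V" if "A \<subseteq> V" for A using that V by (simp add: card_mono)
  have small_empty: "?small {}" using n \<delta> by simp
  have "\<exists>A. ?small A \<and> (\<forall>B. ?small B \<longrightarrow> card B \<le> card A)"
    by (rule ex_has_greatest_nat[of ?small "{}" card "Suc (card V)"])
      (use small_empty bd in \<open>auto simp: less_Suc_eq_le\<close>)
  then obtain A where A: "?small A" and Amax: "\<And>B. ?small B \<Longrightarrow> card B \<le> card A"
    by (elim exE conjE) simp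
  have large_V: "?large V" using n \<delta> E by (auto simp: mult_less_cancel_right1)
  have "\<exists>Z. ?large Z \<and> (\<forall>B. ?large B \<longrightarrow> card Z \<le> card B)"
    by (rule ex_has_least_nat[of ?large V card]) (rule large_V)
  then obtain Z where Z: "?large Z" and Zmin: "\<And>B. ?large B \<Longrightarrow> card Z \<le> card B"
    by (elim exE conjE) simp
  \<comment> \<open>Two small closed sets have a union of size below
    \<open>2 * \<delta> * ?n <= (1 - \<delta>) * ?n\<close>, so by the dichotomy it is small again
    and cannot exceed the maximum.\<close>
  have Asub: "B \<subseteq> A" if B: "?small B" for B
  proof -
    have "real (card (A \<union> B)) \<le> card A + card B"
      using card_Un_le[of A B] by linarith
    then have "\<not> ?large (A \<union> B)" using A B dn by (auto simp: algebra_simps)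
    moreover have "?cl (A \<union> B)" using A B by blast
    ultimately have "?small (A \<union> B)" using dich by blast
    then have "card (A \<union> B) \<le> card A" by (rule Amax)
    then have "A = A \<union> B" using A B fin by (intro card_seteq) auto
    then show ?thesis by blast
  qed
  \<comment> \<open>Dually, two large closed sets meet in more than
    \<open>(1 - 2 * \<delta>) * ?n >= \<delta> * ?n\<close> points.\<close>
  have Zsub: "Z \<subseteq> B" if B: "?large B" for B
  proof -
    have "card (Z \<union> B) + card (Z \<inter> B) = card Z + card B"
      using card_Un_Int[of Z B] Z B fin by simp
    moreover have "card (Z \<union> B) \<le> card V" using Z B bd by simp
    ultimately have "real (card (Z \<inter> B)) \<ge> real (card Z) + card B - ?n"
      by linarith
    then have "\<not> ?small (Z \<inter> B)" using Z B dn by (auto simp: algebra_simps)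
    moreover have "?cl (Z \<inter> B)" using Z B by blast
    ultimately have "?large (Z \<inter> B)" using dich by blast
    then have "card Z \<le> card (Z \<inter> B)" by (rule Zmin)
    then have "Z \<inter> B = Z" using Z fin by (intro card_seteq) auto
    then show ?thesis by blast
  qed
  \<comment> \<open>The set reachable from a \<open>v\<close> outside \<open>A\<close> is closed and
    not contained in \<open>A\<close>, hence large, hence contains \<open>Z\<close>. So any two
    points of \<open>Z - A\<close> reach each other.\<close>
  have reach: "Z \<subseteq> E\<^sup>* `` {v}" if v: "v \<in> Z - A" for v
  proof -
    have "w \<in> V" if "(v, w) \<in> E\<^sup>*" for w
      using that by (induction rule: rtrancl_induct) (use E v Z in auto)
    then have "?cl (E\<^sup>* `` {v})" by (auto intro: rtrancl_into_rtrancl)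
    then have "?small (E\<^sup>* `` {v}) \<or> ?large (E\<^sup>* `` {v})" by (rule dich)
    moreover have "\<not> ?small (E\<^sup>* `` {v})" using Asub v by blast
    ultimately show ?thesis using Zsub by blast
  qed
  have "card Z \<le> card (Z - A) + card A"
    by (metis A Z diff_card_le_card_Diff fin le_diff_conv)
  then have big: "card (Z - A) \<ge> (1 - 2 * \<delta>) * ?n" using A Z by (simp add: algebra_simps)
  have "(1 - 2 * \<delta>) * ?n > 0" using n \<delta> by simp
  then have "card (Z - A) \<noteq> 0" using big by linarith
  then have "Z - A \<noteq> {}" by force
  then obtain v where v: "v \<in> Z - A" by blast
  let ?C = "{w. (v, w) \<in> E\<^sup>* \<and> (w, v) \<in> E\<^sup>*}"
  have scc: "is_scc V E ?C" using v Z E by (intro is_scc_component) auto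
  have "Z - A \<subseteq> ?C" using reach v by blast
  moreover have "?C \<subseteq> V" using scc unfolding is_scc_def strongly_connected_set_def by (elim conjE)
  then have "finite ?C" by (rule fin)
  ultimately have "card (Z - A) \<le> card ?C" by (simp add: card_mono)
  then have "card ?C \<ge> (1 - 2 * \<delta>) * ?n" using big by linarith
  then show ?thesis by (rule that(1)[OF scc])
qed (use that(2) in blast)

subsection \<open>Stable rejection profiles\<close>

text \<open>One term of the exponential series at \<open>x * S\<close>. Unlike a power, the
  exponential of a sum over schools factorises over schools; \<open>x\<close> stays free for a later
  choice.\<close>

lemma power_le_fact_exp:
  fixes S x :: real
  assumes "S \<ge> 0" "x > 0"
  shows "S ^ m \<le> fact m / x ^ m * exp (x * S)"
proof -
  have "(\<Sum>j\<in>{m}. (x * S) ^ j /\<^sub>R fact j) \<le> (\<Sum>j. (x * S) ^ j /\<^sub>R fact j)"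
    by (intro sum_le_suminf summable_exp_generic) (use assms in auto)
  then have "(x * S) ^ m / fact m \<le> exp (x * S)"
    by (simp add: exp_def divide_inverse mult.commute)
  then show ?thesis using assms by (simp add: field_simps power_mult_distrib)
qed

text \<open>Prescribing the school at rank \<open>k\<close> leaves \<open>n - 1\<close> exchangeable
  positions, whence \<open>n - 1\<close> in the denominator; the prescription itself contributes
  \<open>1 / n\<close>.\<close>

lemma sum_preferences_fixed_rank_le:
  fixes y :: "nat \<Rightarrow> real"
  assumes n: "n > 1" and k: "k < n" and m: "m < n" and y: "\<And>s. y s \<ge> 0"
  shows "(\<Sum>p | p \<in> linorders n \<and> p k = m. \<Prod>r<k. y (p r))
    \<le> fact n / n * ((\<Sum>s\<in>{0..<n}. y s) / (real n - 1)) ^ k"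
proof -
  let ?P = "{p. p \<in> linorders n \<and> p k = m}" and ?D = "{0..<n} - {k}"
  let ?S = "\<Sum>s\<in>{0..<n}. y s"
  have S0: "?S \<ge> 0" using y by (simp add: sum_nonneg)
  have S: "(\<Sum>t\<in>?D. y (p t)) \<le> ?S" if "p \<in> ?P" for p
  proof -
    have p: "p permutes {0..<n}" using that by (simp add: linorders_def)
    have "(\<Sum>t\<in>?D. y (p t)) \<le> (\<Sum>t\<in>{0..<n}. y (p t))"
      by (intro sum_mono2) (use y in auto)
    also have "\<dots> = ?S" using sum.permute[OF p, of y] by (simp add: o_def)
    finally show ?thesis .
  qed
  have "real (card ?D) ^ k * (\<Sum>p\<in>?P. \<Prod>r<k. y (p r)) \<le> ?S ^ k * real (card ?P)"
  proof (rule maclaurin_symmetric_family)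
    show "p \<circ> transpose a b \<in> ?P" if "p \<in> ?P" "a \<in> ?D" "b \<in> ?D" for p a b
      using that by (auto intro: comp_transpose_linorders)
  qed (use y S S0 k in auto)
  moreover have "real (card ?D) = real n - 1" using k n by (simp add: of_nat_diff)
  ultimately have *: "(real n - 1) ^ k * (\<Sum>p\<in>?P. \<Prod>r<k. y (p r)) \<le> ?S ^ k * real (card ?P)"
    by simp
  have "real (n * card ?P) \<le> fact n"
    using card_linorders_fixed_value[OF k m] by (metis of_nat_fact of_nat_le_iff)
  then have "real (card ?P) \<le> fact n / n" using n by (simp add: field_simps)
  then have "?S ^ k * real (card ?P) \<le> ?S ^ k * (fact n / n)"
    using S0 by (intro mult_left_mono) auto
  with * have "(real n - 1) ^ k * (\<Sum>p\<in>?P. \<Prod>r<k. y (p r)) \<le> ?S ^ k * (fact n / n)" by simp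
  moreover have "(real n - 1) ^ k > 0" using n by simp
  ultimately have "(\<Sum>p\<in>?P. \<Prod>r<k. y (p r)) \<le> ?S ^ k * (fact n / n) / (real n - 1) ^ k"
    by (simp only: pos_le_divide_eq mult.commute)
  then show ?thesis by (simp add: power_divide mult_ac)
qed

text \<open>Double counting of pairs of a student and a school that rejects her. It regroups a
  product over schools, as it comes from the priorities, into one over students, whose preferences
  are independent.\<close>

lemma prod_power_card_applicants:
  fixes y :: "nat \<Rightarrow> real"
  assumes pref: "\<And>i. i < n \<Longrightarrow> pref i \<in> linorders n" and k: "\<And>i. i < n \<Longrightarrow> k i < n"
  shows "(\<Prod>s\<in>{0..<n}. y s ^ card {i \<in> {0..<n}. s \<in> pref i ` {..<k i}})
    = (\<Prod>i\<in>{0..<n}. \<Prod>r<k i. y (pref i r))"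
proof -
  have "(\<Prod>i\<in>{0..<n}. \<Prod>r<k i. y (pref i r))
      = (\<Prod>i\<in>{0..<n}. \<Prod>s\<in>{0..<n}. if s \<in> pref i ` {..<k i} then y s else 1)"
  proof (rule prod.cong[OF refl])
    fix i assume "i \<in> {0..<n}"
    then have p: "pref i permutes {0..<n}" and ki: "k i < n"
      using pref k by (auto simp: linorders_def)
    have sub: "pref i ` {..<k i} \<subseteq> {0..<n}"
    proof
      fix s assume "s \<in> pref i ` {..<k i}"
      then obtain r where "r < k i" "s = pref i r" by blast
      then have "r < n" "s = pref i r" using ki by auto
      then show "s \<in> {0..<n}" using permutes_in_image[OF p, of r] by simp
    qed
    have "(\<Prod>r<k i. y (pref i r)) = (\<Prod>s\<in>pref i ` {..<k i}. y s)"
      by (subst prod.reindex) (auto simp: o_def intro: inj_on_subset[OF permutes_inj[OF p]])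
    also have "pref i ` {..<k i} = {s \<in> {0..<n}. s \<in> pref i ` {..<k i}}" using sub by auto
    also have "(\<Prod>s\<in>\<dots>. y s) = (\<Prod>s\<in>{0..<n}. if s \<in> pref i ` {..<k i} then y s else 1)"
      by (rule prod.inter_filter) simp
    finally show "(\<Prod>r<k i. y (pref i r))
        = (\<Prod>s\<in>{0..<n}. if s \<in> pref i ` {..<k i} then y s else 1)" .
  qed
  also have "\<dots> = (\<Prod>s\<in>{0..<n}. \<Prod>i\<in>{0..<n}. if s \<in> pref i ` {..<k i} then y s else 1)"
    by (rule prod.swap)
  also have "\<dots> = (\<Prod>s\<in>{0..<n}. y s ^ card {i \<in> {0..<n}. s \<in> pref i ` {..<k i}})"
    by (rule prod.cong[OF refl]) (simp add: prod.inter_filter[symmetric])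
  finally show ?thesis by simp
qed

text \<open>After the exponential bound, the sum over all grid functions factorises into
  \<open>n\<close> equal one-dimensional Riemann sums.\<close>

lemma sum_grid_power_le:
  fixes x :: real
  assumes "N > 0" "x > 0"
  shows "(\<Sum>g\<in>{0..<n} \<rightarrow>\<^sub>E {1..N}. (\<Sum>s\<in>{0..<n}. real (g s) / N) ^ m) / real N ^ n
    \<le> fact m / x ^ m * (exp (x / real N) * (exp x - 1) / x) ^ n"
proof -
  let ?G = "{0..<n} \<rightarrow>\<^sub>E {1..N}"
  have "(\<Sum>g\<in>?G. (\<Sum>s\<in>{0..<n}. real (g s) / N) ^ m)
      \<le> (\<Sum>g\<in>?G. fact m / x ^ m * exp (x * (\<Sum>s\<in>{0..<n}. real (g s) / N)))"
    by (intro sum_mono power_le_fact_exp sum_nonneg) (use assms in auto)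
  also have "\<dots> = fact m / x ^ m * (\<Sum>g\<in>?G. \<Prod>s\<in>{0..<n}. exp (x * (real (g s) / N)))"
    by (simp add: sum_distrib_left exp_sum[symmetric])
  also have "(\<Sum>g\<in>?G. \<Prod>s\<in>{0..<n}. exp (x * (real (g s) / N)))
      = (\<Prod>s\<in>{0..<n}. \<Sum>j\<in>{1..N}. exp (x * (real j / N)))"
    by (rule prod_sum_PiE[symmetric]) auto
  also have "\<dots> = (\<Sum>j\<in>{1..N}. exp (x * (real j / N))) ^ n" by simp
  finally have "(\<Sum>g\<in>?G. (\<Sum>s\<in>{0..<n}. real (g s) / N) ^ m)
      \<le> fact m / x ^ m * (\<Sum>j\<in>{1..N}. exp (x * (real j / N))) ^ n" .
  then have "(\<Sum>g\<in>?G. (\<Sum>s\<in>{0..<n}. real (g s) / N) ^ m) / real N ^ n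
      \<le> fact m / x ^ m * (\<Sum>j\<in>{1..N}. exp (x * (real j / N))) ^ n / real N ^ n"
    by (rule divide_right_mono) simp
  then have "(\<Sum>g\<in>?G. (\<Sum>s\<in>{0..<n}. real (g s) / N) ^ m) / real N ^ n
      \<le> fact m / x ^ m * ((\<Sum>j\<in>{1..N}. exp (x * (real j / N))) / real N) ^ n"
    by (simp only: power_divide times_divide_eq_right)
  also have "\<dots> \<le> fact m / x ^ m * (exp (x / real N) * (exp x - 1) / x) ^ n"
    by (intro mult_left_mono power_mono exp_riemann_sum_le divide_nonneg_nonneg sum_nonneg)
      (use assms in auto)
  finally show ?thesis .
qed

text \<open>Given the preferences, stability is one condition per school: its partner comes before
  all students it rejected. The resulting factors \<open>1 / (1 + b)\<close> are replaced by
  averages of grid powers, regrouped by student and bounded by the Maclaurin estimate.\<close>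

lemma card_stable_fixed_matching_le:
  fixes x :: real
  assumes n: "n > 1" and k: "\<And>i. i < n \<Longrightarrow> k i < n" and \<mu>: "\<mu> permutes {0..<n}"
    and N: "N > 0" and x: "x > 0"
  defines "m \<equiv> \<Sum>i\<in>{0..<n}. k i"
  shows "real (card {(pref, prio) \<in> problems n.
            stable_profile n pref prio k \<and> (\<forall>i<n. pref i (k i) = \<mu> i)})
    \<le> fact n ^ n * (fact n / n) ^ n / (real n - 1) ^ m *
        (fact m / x ^ m * (exp (x / real N) * (exp x - 1) / x) ^ n)"
proof -
  let ?I = "{0..<n}" and ?G = "{0..<n} \<rightarrow>\<^sub>E {1..N}"
  let ?X = "{(pref, prio) \<in> problems n.
            stable_profile n pref prio k \<and> (\<forall>i<n. pref i (k i) = \<mu> i)}"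
  let ?A = "\<lambda>pref s. {i \<in> ?I. s \<in> pref i ` {..<k i}}"
  let ?Pf = "\<lambda>i. {p. p \<in> linorders n \<and> p (k i) = \<mu> i}"
  let ?Q = "\<lambda>pref s. {p \<in> linorders n. \<forall>a\<in>?A pref s. inv p (inv \<mu> s) \<le> inv p a}"
  have \<mu>n: "\<mu> i < n" if "i < n" for i using permutes_in_image[OF \<mu>, of i] that by simp
  have sub: "?X \<subseteq> Sigma (PiE ?I ?Pf) (\<lambda>pref. PiE ?I (?Q pref))"
  proof
    fix z assume "z \<in> ?X"
    then obtain pref prio where z: "z = (pref, prio)" and P: "(pref, prio) \<in> problems n"
      and st: "stable_profile n pref prio k" and eq: "\<forall>i<n. pref i (k i) = \<mu> i" by blast
    have 1: "pref \<in> PiE ?I ?Pf" using P eq by (auto simp: problems_def PiE_iff)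
    have "inv (prio s) (inv \<mu> s) \<le> inv (prio s) a" if s: "s < n" and a: "a \<in> ?A pref s" for s a
    proof -
      obtain r where r: "a < n" "r < k a" "s = pref a r" using a by auto
      have "inv \<mu> s < n" using permutes_in_image[OF permutes_inv[OF \<mu>], of s] s by simp
      moreover have "\<mu> (inv \<mu> s) = s" using permutes_inverses(1)[OF \<mu>] .
      ultimately show ?thesis using st r eq unfolding stable_profile_def by metis
    qed
    then have "prio \<in> PiE ?I (?Q pref)" using P by (auto simp: problems_def PiE_iff)
    with 1 show "z \<in> Sigma (PiE ?I ?Pf) (\<lambda>pref. PiE ?I (?Q pref))" by (simp only: z mem_Sigma_iff simp_thms)
  qed
  have finPf: "finite (?Pf i)" for i by (rule finite_subset[OF _ finite_linorders[of n]]) auto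
  have finPfE: "finite (PiE ?I ?Pf)" by (intro finite_PiE) (auto simp: finPf)
  have "card ?X \<le> card (Sigma (PiE ?I ?Pf) (\<lambda>pref. PiE ?I (?Q pref)))"
    by (intro card_mono sub finite_SigmaI finite_PiE finPfE) auto
  also have "\<dots> = (\<Sum>pref\<in>PiE ?I ?Pf. \<Prod>s\<in>?I. card (?Q pref s))"
    by (simp add: card_SigmaI finPfE finite_PiE card_PiE)
  finally have "real (card ?X) \<le> (\<Sum>pref\<in>PiE ?I ?Pf. \<Prod>s\<in>?I. real (card (?Q pref s)))"
    by (simp only: of_nat_le_iff[symmetric, where ?'a = real] of_nat_sum of_nat_prod)
  also have "\<dots> \<le> (\<Sum>pref\<in>PiE ?I ?Pf. \<Prod>s\<in>?I.
      \<Sum>j\<in>{1..N}. fact n / real N * (real j / real N) ^ card (?A pref s))"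
  proof (intro sum_mono prod_mono conjI)
    fix pref s assume pref: "pref \<in> PiE ?I ?Pf" and s: "s \<in> ?I"
    have im: "inv \<mu> s < n" using permutes_in_image[OF permutes_inv[OF \<mu>], of s] s by simp
    \<comment> \<open>The partner ranks \<open>s\<close> at exactly \<open>k\<close>, not earlier,
      so it is not counted among the \<open>b\<close> rejected students.\<close>
    have "inv \<mu> s \<notin> ?A pref s"
    proof
      assume "inv \<mu> s \<in> ?A pref s"
      then obtain r where r: "r < k (inv \<mu> s)" "s = pref (inv \<mu> s) r" by auto
      have "pref (inv \<mu> s) (k (inv \<mu> s)) = s" "pref (inv \<mu> s) permutes ?I"
        using pref im permutes_inverses(1)[OF \<mu>] by (auto simp: PiE_iff linorders_def)
      then have "k (inv \<mu> s) = r" using r permutes_inj by (metis injD)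
      with r show False by simp
    qed
    then have "(card (?A pref s) + 1) * card (?Q pref s) \<le> fact n"
      using im by (intro card_linorders_best) auto
    then have "real ((card (?A pref s) + 1) * card (?Q pref s)) \<le> real (fact n)"
      by (rule of_nat_mono)
    then have "real (card (?Q pref s)) \<le> fact n * (1 / (1 + real (card (?A pref s))))"
      by (simp add: field_simps)
    also have "\<dots> \<le> fact n * ((\<Sum>j\<in>{1..N}. (real j / real N) ^ card (?A pref s)) / real N)"
      by (intro mult_left_mono inverse_Suc_le_riemann_sum N) auto
    also have "\<dots> = (\<Sum>j\<in>{1..N}. fact n / real N * (real j / real N) ^ card (?A pref s))"
      by (simp add: sum_distrib_left sum_divide_distrib)
    finally show "real (card (?Q pref s))
        \<le> (\<Sum>j\<in>{1..N}. fact n / real N * (real j / real N) ^ card (?A pref s))" .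
  qed simp
  \<comment> \<open>\<open>g\<close> picks a grid point for every school; expanding the product over
    schools into a sum over \<open>g\<close> lets the exponents be regrouped by student.\<close>
  also have "\<dots> = (\<Sum>pref\<in>PiE ?I ?Pf. \<Sum>g\<in>?G. (fact n / real N) ^ n *
      (\<Prod>i\<in>?I. \<Prod>r<k i. real (g (pref i r)) / real N))"
  proof (intro sum.cong refl)
    fix pref assume pref: "pref \<in> PiE ?I ?Pf"
    have "(\<Prod>s\<in>?I. \<Sum>j\<in>{1..N}. fact n / real N * (real j / real N) ^ card (?A pref s))
        = (\<Sum>g\<in>?G. \<Prod>s\<in>?I. fact n / real N * (real (g s) / real N) ^ card (?A pref s))"
      by (rule prod_sum_PiE) auto
    also have "\<dots> = (\<Sum>g\<in>?G. (fact n / real N) ^ n *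
        (\<Prod>s\<in>?I. (real (g s) / real N) ^ card (?A pref s)))"
      by (simp only: prod.distrib prod_constant card_atLeastLessThan diff_zero)
    also have "\<dots> = (\<Sum>g\<in>?G. (fact n / real N) ^ n *
        (\<Prod>i\<in>?I. \<Prod>r<k i. real (g (pref i r)) / real N))"
    proof (intro sum.cong refl arg_cong2[where f = "(*)"])
      fix g :: "nat \<Rightarrow> nat"
      show "(\<Prod>s\<in>?I. (real (g s) / real N) ^ card (?A pref s))
          = (\<Prod>i\<in>?I. \<Prod>r<k i. real (g (pref i r)) / real N)"
        by (rule prod_power_card_applicants) (use pref k in \<open>auto simp: PiE_iff\<close>)
    qed
    finally show "(\<Prod>s\<in>?I. \<Sum>j\<in>{1..N}. fact n / real N * (real j / real N) ^ card (?A pref s))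
        = (\<Sum>g\<in>?G. (fact n / real N) ^ n * (\<Prod>i\<in>?I. \<Prod>r<k i. real (g (pref i r)) / real N))" .
  qed
  also have "\<dots> = (\<Sum>g\<in>?G. (fact n / real N) ^ n *
      (\<Sum>pref\<in>PiE ?I ?Pf. \<Prod>i\<in>?I. \<Prod>r<k i. real (g (pref i r)) / real N))"
    by (subst sum.swap) (simp add: sum_distrib_left)
  also have "\<dots> = (\<Sum>g\<in>?G. (fact n / real N) ^ n *
      (\<Prod>i\<in>?I. \<Sum>p\<in>?Pf i. \<Prod>r<k i. real (g (p r)) / real N))"
  proof (intro sum.cong refl arg_cong2[where f = "(*)"])
    fix g :: "nat \<Rightarrow> nat"
    show "(\<Sum>pref\<in>PiE ?I ?Pf. \<Prod>i\<in>?I. \<Prod>r<k i. real (g (pref i r)) / real N)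
        = (\<Prod>i\<in>?I. \<Sum>p\<in>?Pf i. \<Prod>r<k i. real (g (p r)) / real N)"
      by (rule prod_sum_PiE[symmetric]) (auto simp: finPf)
  qed
  also have "\<dots> \<le> (\<Sum>g\<in>?G. (fact n / real N) ^ n *
      (\<Prod>i\<in>?I. fact n / n * ((\<Sum>s\<in>?I. real (g s) / real N) / (real n - 1)) ^ k i))"
  proof (intro sum_mono mult_left_mono prod_mono conjI)
    fix g :: "nat \<Rightarrow> nat" and i assume i: "i \<in> ?I"
    show "(\<Sum>p\<in>?Pf i. \<Prod>r<k i. real (g (p r)) / real N)
        \<le> fact n / n * ((\<Sum>s\<in>?I. real (g s) / real N) / (real n - 1)) ^ k i"
      by (rule sum_preferences_fixed_rank_le) (use i n k \<mu>n in auto)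
  qed (auto intro!: sum_nonneg prod_nonneg)
  also have "\<dots> = (\<Sum>g\<in>?G. (fact n / real N) ^ n *
      ((fact n / n) ^ n * ((\<Sum>s\<in>?I. real (g s) / real N) / (real n - 1)) ^ m))"
    by (simp only: prod.distrib prod_constant card_atLeastLessThan diff_zero power_sum[symmetric] m_def)
  also have "\<dots> = fact n ^ n * (fact n / n) ^ n / (real n - 1) ^ m *
      ((\<Sum>g\<in>?G. (\<Sum>s\<in>?I. real (g s) / N) ^ m) / real N ^ n)"
  proof -
    have "(fact n / real N) ^ n * (c * (T / (real n - 1)) ^ m)
        = fact n ^ n * c / (real n - 1) ^ m * (T ^ m / real N ^ n)" for c T :: real
      by (simp add: power_divide mult_ac)
    then show ?thesis by (simp only: sum_distrib_left[symmetric] sum_divide_distrib[symmetric])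
  qed
  also have "\<dots> \<le> fact n ^ n * (fact n / n) ^ n / (real n - 1) ^ m *
      (fact m / x ^ m * (exp (x / real N) * (exp x - 1) / x) ^ n)"
    using n by (intro mult_left_mono sum_grid_power_le N x) auto
  finally show ?thesis .
qed

section \<open>Union bounds over profiles and matchings\<close>

lemma finite_problems [simp]: "finite (problems n)"
  by (simp add: problems_def finite_PiE)

lemma card_problems: "card (problems n) = (fact n * fact n) ^ n"
  by (simp add: problems_def card_cartesian_product card_PiE card_linorders power_mult_distrib)

text \<open>Union bound over the profiles and the \<open>n!\<close> matchings; the common total
  \<open>m\<close> makes the individual bounds equal.\<close>

lemma card_stable_family_le:
  fixes x :: real
  assumes n: "n > 1" and \<K>: "\<K> \<subseteq> {0..<n} \<rightarrow>\<^sub>E {0..<n}" and m: "\<And>k. k \<in> \<K> \<Longrightarrow> (\<Sum>i\<in>{0..<n}. k i) = m"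
    and N: "N > 0" and x: "x > 0"
  shows "real (card {(pref, prio) \<in> problems n. \<exists>k\<in>\<K>. stable_profile n pref prio k})
    \<le> real (card \<K>) * fact n * (fact n ^ n * (fact n / n) ^ n / (real n - 1) ^ m *
        (fact m / x ^ m * (exp (x / real N) * (exp x - 1) / x) ^ n))" (is "_ \<le> _ * _ * ?b")
proof -
  let ?X = "\<lambda>k \<mu>. {(pref, prio) \<in> problems n.
      stable_profile n pref prio k \<and> (\<forall>i<n. pref i (k i) = \<mu> i)}"
  let ?U = "{(pref, prio) \<in> problems n. \<exists>k\<in>\<K>. stable_profile n pref prio k}"
  have fin\<K>: "finite \<K>" using \<K> by (rule finite_subset) (simp add: finite_PiE)
  have finX: "finite (?X k \<mu>)" for k \<mu> by (rule finite_subset[OF _ finite_problems[of n]]) auto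
  have "?U \<subseteq> (\<Union>k\<in>\<K>. \<Union>\<mu>\<in>linorders n. ?X k \<mu>)"
  proof
    fix z assume "z \<in> ?U"
    then obtain pref prio k where z: "z = (pref, prio)" "(pref, prio) \<in> problems n" "k \<in> \<K>"
      "stable_profile n pref prio k" by blast
    define \<mu> where "\<mu> = (\<lambda>i. if i < n then pref i (k i) else i)"
    have "bij_betw \<mu> {0..<n} {0..<n}"
      using stable_profile_bij[OF z(2,4)] by (rule bij_betw_cong[THEN iffD1, rotated]) (simp add: \<mu>_def)
    then have "\<mu> \<in> linorders n"
      unfolding linorders_def by (auto intro!: bij_imp_permutes simp: \<mu>_def)
    moreover have "z \<in> ?X k \<mu>" using z by (simp add: \<mu>_def)
    ultimately show "z \<in> (\<Union>k\<in>\<K>. \<Union>\<mu>\<in>linorders n. ?X k \<mu>)" using z(3) by blast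
  qed
  then have "card ?U \<le> card (\<Union>k\<in>\<K>. \<Union>\<mu>\<in>linorders n. ?X k \<mu>)"
    by (intro card_mono finite_UN_I fin\<K> finX) auto
  also have "\<dots> \<le> (\<Sum>k\<in>\<K>. card (\<Union>\<mu>\<in>linorders n. ?X k \<mu>))"
    by (rule card_UN_le[OF fin\<K>])
  also have "\<dots> \<le> (\<Sum>k\<in>\<K>. \<Sum>\<mu>\<in>linorders n. card (?X k \<mu>))"
    by (intro sum_mono card_UN_le) simp
  finally have "real (card ?U) \<le> real (\<Sum>k\<in>\<K>. \<Sum>\<mu>\<in>linorders n. card (?X k \<mu>))"
    by (rule of_nat_mono)
  also have "\<dots> = (\<Sum>k\<in>\<K>. \<Sum>\<mu>\<in>linorders n. real (card (?X k \<mu>)))" by (simp only: of_nat_sum)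
  also have "\<dots> \<le> (\<Sum>k\<in>\<K>. \<Sum>\<mu>\<in>linorders n. ?b)"
  proof (intro sum_mono)
    fix k \<mu> assume k: "k \<in> \<K>" and \<mu>: "\<mu> \<in> linorders n"
    have kn: "k i < n" if "i < n" for i using \<K> k that by (auto simp: PiE_iff)
    have "\<mu> permutes {0..<n}" using \<mu> by (simp add: linorders_def)
    from card_stable_fixed_matching_le[of n k \<mu>, OF n kn this N x] show "real (card (?X k \<mu>)) \<le> ?b"
      unfolding m[OF k] .
  qed
  also have "\<dots> = real (card \<K>) * fact n * ?b"
    by (simp only: sum_constant card_linorders of_nat_fact mult.assoc)
  finally show ?thesis .
qed

text \<open>Weighting a profile by \<open>z ^ m\<close> decouples its coordinates: a free one
  contributes at most the geometric series \<open>1 / (1 - z)\<close>, one in \<open>B\<close> at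
  most \<open>K\<close>.\<close>

lemma card_profiles_le:
  fixes m n K :: nat
  assumes n: "n > 0" and B: "B \<subseteq> {0..<n}"
  defines "M \<equiv> m + n"
  shows "real (card {k \<in> {0..<n} \<rightarrow>\<^sub>E {0..<n}. (\<Sum>i\<in>{0..<n}. k i) = m \<and> (\<forall>i\<in>B. k i < K)})
    \<le> (real K * n / M) ^ card B * (real M ^ M / (real m ^ m * real n ^ n))"
proof -
  let ?I = "{0..<n}"
  let ?\<K> = "{k \<in> ?I \<rightarrow>\<^sub>E ?I. (\<Sum>i\<in>?I. k i) = m \<and> (\<forall>i\<in>B. k i < K)}"
  let ?R = "\<lambda>i. if i \<in> B then {j\<in>?I. j < K} else ?I"
  \<comment> \<open>This \<open>z\<close> minimises \<open>1 / ((1 - z) ^ n * z ^ m)\<close>, the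
    bound obtained from free coordinates. For \<open>m = 0\<close> it is 0, and
    \<open>z ^ m = 1\<close> still permits the division.\<close>
  define z where "z = real m / M"
  have M: "M > 0" using n by (simp add: M_def)
  have z: "0 \<le> z" "z < 1" "1 - z = n / M" using n by (auto simp: z_def M_def field_simps)
  have "?\<K> \<subseteq> PiE ?I ?R" by (auto simp: PiE_iff extensional_def)
  then have "(\<Sum>k\<in>?\<K>. z ^ (\<Sum>i\<in>?I. k i)) \<le> (\<Sum>k\<in>PiE ?I ?R. z ^ (\<Sum>i\<in>?I. k i))"
    using z by (intro sum_mono2 finite_PiE) auto
  also have "\<dots> = (\<Sum>k\<in>PiE ?I ?R. \<Prod>i\<in>?I. z ^ k i)" by (simp add: power_sum)
  also have "\<dots> = (\<Prod>i\<in>?I. \<Sum>j\<in>?R i. z ^ j)" by (rule prod_sum_PiE[symmetric]) auto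
  also have "\<dots> \<le> (\<Prod>i\<in>?I. if i \<in> B then real K else M / n)"
  proof (intro prod_mono conjI)
    fix i assume "i \<in> ?I"
    show "(\<Sum>j\<in>?R i. z ^ j) \<le> (if i \<in> B then real K else M / n)"
    proof (cases "i \<in> B")
      case True
      have "(\<Sum>j\<in>{j\<in>?I. j < K}. z ^ j) \<le> (\<Sum>j<K. 1)"
        by (rule order_trans[OF sum_mono sum_mono2]) (use z in \<open>auto simp: power_le_one\<close>)
      then show ?thesis using True by simp
    next
      case False
      have "(\<Sum>j\<in>?I. z ^ j) = (\<Sum>j<n. z ^ j)" by (simp add: lessThan_atLeast0)
      also have "\<dots> \<le> (\<Sum>j. z ^ j)" by (rule sum_le_suminf) (use z in \<open>auto simp: summable_geometric\<close>)
      also have "\<dots> = 1 / (1 - z)" using z by (intro suminf_geometric) auto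
      also have "\<dots> = M / n" using z by simp
      finally show ?thesis using False by simp
    qed
  qed (use z in \<open>auto intro!: sum_nonneg\<close>)
  also have "\<dots> = real K ^ card B * (M / n) ^ (n - card B)"
  proof -
    have "?I \<inter> {i. i \<in> B} = B" "?I \<inter> - {i. i \<in> B} = ?I - B" using B by auto
    moreover have "card (?I - B) = n - card B" using B finite_subset by (subst card_Diff_subset) auto
    ultimately show ?thesis by (simp add: prod.If_cases)
  qed
  also have "\<dots> = (real K * n / M) ^ card B * (M / n) ^ n"
  proof -
    have "card B \<le> n" using B card_mono[of ?I B] by simp
    then have "(M / n) ^ n = (M / n) ^ card B * (M / n) ^ (n - card B)"
      by (simp add: power_add[symmetric])
    moreover have "(real K * n / M) ^ card B * (M / n) ^ card B = real K ^ card B"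
      using n M by (simp add: power_mult_distrib[symmetric])
    ultimately show ?thesis by (simp add: mult.assoc[symmetric])
  qed
  finally have "real (card ?\<K>) * z ^ m \<le> (real K * n / M) ^ card B * (M / n) ^ n" by simp
  moreover have zm: "z ^ m > 0" using M by (cases "m = 0") (auto simp: z_def)
  ultimately have "real (card ?\<K>) \<le> (real K * n / M) ^ card B * ((M / n) ^ n / z ^ m)"
    by (simp add: pos_le_divide_eq)
  also have "(M / n) ^ n / z ^ m = real M ^ M / (real m ^ m * real n ^ n)"
    by (simp add: z_def power_divide M_def power_add mult.commute)
  finally show ?thesis .
qed

text \<open>Here \<open>m\<close> is the total number of rejections, and the factor \<open>(1 - exp (-(m + n) / n)) ^ n\<close>
  is the coupon collector probability that \<open>m + n\<close> applications reach all schools.\<close>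

lemma stable_profile_probability_le:
  assumes n: "n > 1" and B: "B \<subseteq> {0..<n}"
  shows "real (card {(pref, prio) \<in> problems n. \<exists>k. stable_profile n pref prio k \<and>
            (\<Sum>i\<in>{0..<n}. k i) = m \<and> (\<forall>i\<in>B. k i < K)}) / real (card (problems n))
    \<le> (real K * n / real (m + n)) ^ card B * (exp 3 * (real n + 1) * (real m + 1) *
        (n / (real n - 1)) ^ m * (1 - exp (- (real (m + n) / n))) ^ n)"
proof -
  define M where "M = m + n"
  \<comment> \<open>This choice lets \<open>x ^ m * x ^ n\<close> cancel the \<open>M ^ M\<close> of
    the profile count and makes \<open>(exp x - 1) ^ n\<close> equal to \<open>exp M\<close> times
    the coupon collector factor.\<close>
  define x where "x = real M / n"
  let ?\<K> = "{k \<in> {0..<n} \<rightarrow>\<^sub>E {0..<n}. (\<Sum>i\<in>{0..<n}. k i) = m \<and> (\<forall>i\<in>B. k i < K)}"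
  let ?c = "(real K * n / M) ^ card B" and ?g = "(1 - exp (- x)) ^ n"
  have M: "M > 0" and x: "x > 0" using n by (auto simp: M_def x_def)
  have "stable_profile n pref prio (restrict k {0..<n})" if "stable_profile n pref prio k" for pref prio k
    using that unfolding stable_profile_def by (auto simp: inj_on_def)
  moreover have "restrict k {0..<n} \<in> ?\<K>"
    if "stable_profile n pref prio k" "(\<Sum>i\<in>{0..<n}. k i) = m" "\<forall>i\<in>B. k i < K" for pref prio k
    using that B unfolding stable_profile_def by (auto simp: subset_iff)
  ultimately have "{(pref, prio) \<in> problems n. \<exists>k. stable_profile n pref prio k \<and>
            (\<Sum>i\<in>{0..<n}. k i) = m \<and> (\<forall>i\<in>B. k i < K)}
      \<subseteq> {(pref, prio) \<in> problems n. \<exists>k\<in>?\<K>. stable_profile n pref prio k}" (is "?U \<subseteq> ?V")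
    by blast
  then have "real (card ?U) \<le> real (card ?V)"
    by (intro of_nat_mono card_mono finite_subset[OF _ finite_problems[of n]]) auto
  \<comment> \<open>The grid size is \<open>M\<close>, so the right endpoints cost only
    \<open>exp (x / M) ^ n = exp 1\<close>.\<close>
  also have "\<dots> \<le> real (card ?\<K>) * fact n * (fact n ^ n * (fact n / n) ^ n / (real n - 1) ^ m *
        (fact m / x ^ m * (exp (x / real M) * (exp x - 1) / x) ^ n))"
    by (rule card_stable_family_le[OF n _ _ M x]) auto
  finally have "real (card ?U) / (fact n * fact n) ^ n \<le>
      real (card ?\<K>) * fact n * (fact n ^ n * (fact n / n) ^ n / (real n - 1) ^ m *
        (fact m / x ^ m * (exp (x / real M) * (exp x - 1) / x) ^ n)) / (fact n * fact n) ^ n"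
    by (rule divide_right_mono) simp
  also have "\<dots> = real (card ?\<K>) * (exp 1 * fact n * fact m * (n / (real n - 1)) ^ m * exp M / real M ^ M * ?g)"
  proof -
    have e1: "exp (x / real M) ^ n = exp 1"
      using M n by (simp add: exp_of_nat_mult[symmetric] x_def)
    have e2: "(exp x - 1) ^ n = exp M * ?g"
    proof -
      have "exp x - 1 = exp x * (1 - exp (- x))" by (simp add: right_diff_distrib exp_minus)
      then have "(exp x - 1) ^ n = exp x ^ n * ?g" by (simp add: power_mult_distrib)
      also have "exp x ^ n = exp M" using n by (simp add: exp_of_nat_mult[symmetric] x_def)
      finally show ?thesis .
    qed
    have e3: "x ^ m * x ^ n = real M ^ M / real n ^ M"
      by (simp add: power_add[symmetric] x_def M_def power_divide)
    have "fact n * (fact n ^ n * (fact n / n) ^ n / (real n - 1) ^ m *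
        (fact m / x ^ m * (exp (x / real M) * (exp x - 1) / x) ^ n)) / (fact n * fact n) ^ n
      = fact n * fact m / (real n ^ n * (real n - 1) ^ m) *
        (exp (x / real M) ^ n * (exp x - 1) ^ n) / (x ^ m * x ^ n)"
      by (simp add: power_divide power_mult_distrib)
    also have "\<dots> = exp 1 * fact n * fact m * (n / (real n - 1)) ^ m * exp M / real M ^ M * ?g"
      using n M unfolding e1 e2 e3 by (simp add: power_divide M_def power_add)
    finally show ?thesis
      by (rule arg_cong[where f = "\<lambda>t. real (card ?\<K>) * t", elim_format])
        (simp only: mult.assoc times_divide_eq_right)
  qed
  also have "\<dots> \<le> (?c * (real M ^ M / (real m ^ m * real n ^ n))) *
      (exp 1 * fact n * fact m * (n / (real n - 1)) ^ m * exp M / real M ^ M * ?g)"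
    using card_profiles_le[of n B m K] n B x
    by (intro mult_right_mono) (auto simp: M_def intro!: mult_nonneg_nonneg divide_nonneg_nonneg)
  \<comment> \<open>Grouped so that Stirling applies to \<open>n!\<close> and \<open>m!\<close>
    separately, at the price of a linear factor each.\<close>
  also have "\<dots> = ?c * exp 1 * (fact n * exp n / real n ^ n) * (fact m * exp m / real m ^ m) *
      (n / (real n - 1)) ^ m * ?g"
  proof -
    have rearrange: "P \<noteq> 0 \<Longrightarrow> c * (P / (a * b)) * (e * f * h * q * (E * F) / P * g)
        = c * e * (f * F / b) * (h * E / a) * q * g" for P a b c e f g h q E F :: real
      by (simp add: mult_ac)
    have "exp M = exp (real m) * exp (real n)" by (simp add: M_def exp_add)
    moreover have "real M ^ M \<noteq> 0" using M by simp
    ultimately show ?thesis by (simp only: rearrange not_False_eq_True)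
  qed
  also have "\<dots> \<le> ?c * exp 1 * (exp 1 * (real n + 1)) * (exp 1 * (real m + 1)) *
      (n / (real n - 1)) ^ m * ?g"
  proof -
    have "fact n * exp (real n) / real n ^ n \<le> exp 1 * (real n + 1)" for n :: nat
      using fact_exp_le[of n] by (cases "n = 0") (auto simp: pos_divide_le_eq)
    then show ?thesis using n x
      by (intro mult_right_mono mult_mono mult_left_mono) auto
  qed
  also have "\<dots> = ?c * (exp 3 * (real n + 1) * (real m + 1) * (n / (real n - 1)) ^ m * ?g)"
  proof -
    have "exp 3 = exp 1 * exp 1 * (exp 1 :: real)" by (simp add: exp_add[symmetric])
    then show ?thesis by simp
  qed
  finally show ?thesis by (simp add: M_def x_def card_problems)
qed

subsection \<open>Probability bounds\<close>

lemma ratio_power_le_exp: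
  assumes "n > 1"
  shows "(n / (real n - 1)) ^ m \<le> exp (m / (real n - 1))"
proof -
  have "n / (real n - 1) = 1 + 1 / (real n - 1)" using assms by (simp add: field_simps)
  also have "\<dots> \<le> exp (1 / (real n - 1))" by (rule exp_ge_add_one_self)
  finally have "(n / (real n - 1)) ^ m \<le> exp (1 / (real n - 1)) ^ m"
    using assms by (intro power_mono) auto
  then show ?thesis by (simp add: exp_of_nat_mult[symmetric])
qed

lemma card_UN_divide_le:
  assumes "finite I" "c \<ge> 0" and "\<And>i. i \<in> I \<Longrightarrow> real (card (V i)) / c \<le> b"
  shows "real (card (\<Union>i\<in>I. V i)) / c \<le> real (card I) * b"
proof -
  have "real (card (\<Union>i\<in>I. V i)) / c \<le> real (\<Sum>i\<in>I. card (V i)) / c"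
    using assms by (intro divide_right_mono of_nat_mono card_UN_le)
  also have "\<dots> = (\<Sum>i\<in>I. real (card (V i)) / c)" by (simp add: sum_divide_distrib)
  also have "\<dots> \<le> (\<Sum>i\<in>I. b)" by (intro sum_mono assms)
  finally show ?thesis by simp
qed

text \<open>For \<open>m <= C * n\<close> the base of the coupon collector factor is bounded away
  from 1, and the correction \<open>(n / (n - 1)) ^ m\<close> is bounded by a constant.\<close>

lemma few_applications_probability_le:
  assumes n: "n > 1" and m: "m \<le> C * n"
  shows "real (card {(pref, prio) \<in> problems n. \<exists>k. stable_profile n pref prio k \<and>
            (\<Sum>i\<in>{0..<n}. k i) = m}) / real (card (problems n))
    \<le> exp 3 * (real n + 1) * (real C * n + 1) * exp (2 * real C) * exp (- (exp (- (real C + 1)) * n))"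
proof -
  have "real (card {(pref, prio) \<in> problems n. \<exists>k. stable_profile n pref prio k \<and>
            (\<Sum>i\<in>{0..<n}. k i) = m}) / real (card (problems n))
      \<le> exp 3 * (real n + 1) * (real m + 1) *
        (n / (real n - 1)) ^ m * (1 - exp (- (real (m + n) / n))) ^ n"
    using stable_profile_probability_le[OF n, of "{}" m 0] by simp
  also have "\<dots> \<le> exp 3 * (real n + 1) * (real C * n + 1) *
      exp (2 * real C) * exp (- (exp (- (real C + 1)) * n))"
  proof (intro mult_mono)
    show "real m + 1 \<le> real C * n + 1" using m by (metis add_right_mono of_nat_le_iff of_nat_mult)
    have "real m / (real n - 1) \<le> real C * n / (real n - 1)"
      using m n by (intro divide_right_mono) (auto simp flip: of_nat_mult)
    also have "\<dots> \<le> 2 * real C"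
    proof -
      have "real C * n \<le> C * (2 * (real n - 1))" using n by (intro mult_left_mono) auto
      then show ?thesis using n by (simp add: pos_divide_le_eq mult_ac)
    qed
    finally show "(n / (real n - 1)) ^ m \<le> exp (2 * real C)"
      using ratio_power_le_exp[OF n, of m] by (meson exp_le_cancel_iff order_trans)
    have "real m + n \<le> (real C + 1) * n"
      using m by (simp add: distrib_right flip: of_nat_mult)
    then have "real (m + n) / n \<le> real C + 1" using n by (simp add: pos_divide_le_eq)
    then have "1 - exp (- (real (m + n) / n)) \<le> 1 - exp (- (real C + 1))" by simp
    also have "\<dots> \<le> exp (- exp (- (real C + 1)))"
      using exp_ge_add_one_self[of "- exp (- (real C + 1))"] by simp
    finally have "(1 - exp (- (real (m + n) / n))) ^ n \<le> exp (- exp (- (real C + 1))) ^ n"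
      by (intro power_mono) auto
    then show "(1 - exp (- (real (m + n) / n))) ^ n \<le> exp (- (exp (- (real C + 1)) * n))"
      by (simp add: exp_of_nat_mult[symmetric] mult.commute)
  qed (use n in auto)
  finally show ?thesis .
qed

text \<open>The coupon collector factor is bounded by 1 here. As \<open>m < n * n\<close>, the
  correction is at most \<open>exp (2 * n)\<close>, while each student in \<open>B\<close>
  contributes a factor at most \<open>K / C\<close>; the constant \<open>4 / \<delta>\<close> makes
  these at most \<open>exp (- 4 * n)\<close> together. The remaining \<open>exp (- 2 * n)\<close>
  outweighs the \<open>2 ^ n\<close> choices of \<open>B\<close>.\<close>

lemma many_applications_probability_le:
  fixes \<delta> :: real and C :: nat
  assumes n: "n > 1" and B: "B \<subseteq> {0..<n}" and m: "C * n < m" "m < n * n"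
    and \<delta>: "\<delta> > 0" and C: "C > 0" "real K / C \<le> exp (- (4 / \<delta>))" and card_B: "\<delta> * n \<le> card B"
  shows "real (card {(pref, prio) \<in> problems n. \<exists>k. stable_profile n pref prio k \<and>
            (\<Sum>i\<in>{0..<n}. k i) = m \<and> (\<forall>i\<in>B. k i < K)}) / real (card (problems n))
    \<le> exp 3 * (real n + 1) * (real n * n + 1) * exp (- (2 * real n))"
proof -
  have "real (card {(pref, prio) \<in> problems n. \<exists>k. stable_profile n pref prio k \<and>
            (\<Sum>i\<in>{0..<n}. k i) = m \<and> (\<forall>i\<in>B. k i < K)}) / real (card (problems n))
      \<le> (real K * n / real (m + n)) ^ card B * (exp 3 * (real n + 1) * (real m + 1) *
        (n / (real n - 1)) ^ m * (1 - exp (- (real (m + n) / n))) ^ n)"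
    by (rule stable_profile_probability_le[OF n B])
  also have "\<dots> \<le> exp (- (4 * real n)) * (exp 3 * (real n + 1) * (real n * n + 1) * exp (2 * real n) * 1)"
  proof (intro mult_mono)
    have "C * n \<le> m + n" using m by simp
    then have "real (C * n) \<le> real (m + n)" by (rule of_nat_mono)
    then have "real K * n / real (m + n) \<le> real K * n / real (C * n)"
      using C(1) n by (intro divide_left_mono) auto
    also have "\<dots> = real K / C" using n by simp
    also note C(2)
    finally have "(real K * n / real (m + n)) ^ card B \<le> exp (- (4 / \<delta>)) ^ card B"
      by (intro power_mono) auto
    also have "\<dots> = exp (- (4 / \<delta>) * card B)" by (simp add: exp_of_nat_mult[symmetric] mult.commute)
    also have "\<dots> \<le> exp (- (4 * real n))"
    proof -
      have "n \<le> card B / \<delta>" using card_B \<delta> by (simp add: pos_le_divide_eq mult.commute)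
      then show ?thesis by simp
    qed
    finally show "(real K * n / real (m + n)) ^ card B \<le> exp (- (4 * real n))" .
    show "real m + 1 \<le> real n * n + 1" using m(2) by (simp flip: of_nat_mult)
    have "real m / (real n - 1) \<le> real n * n / (real n - 1)"
      using m n by (intro divide_right_mono) (auto simp flip: of_nat_mult)
    also have "\<dots> \<le> 2 * real n"
    proof -
      have "real n * n \<le> n * (2 * (real n - 1))" using n by (intro mult_left_mono) auto
      then show ?thesis using n by (simp add: pos_divide_le_eq mult_ac)
    qed
    finally show "(n / (real n - 1)) ^ m \<le> exp (2 * real n)"
      using ratio_power_le_exp[OF n, of m] by (meson exp_le_cancel_iff order_trans)
    show "(1 - exp (- (real (m + n) / n))) ^ n \<le> 1" by (intro power_le_one) auto
  qed (use n in auto)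
  also have "\<dots> = exp 3 * (real n + 1) * (real n * n + 1) * exp (- (2 * real n))"
  proof -
    have "exp (- (4 * real n)) * exp (2 * real n) = exp (- (2 * real n))"
      by (simp add: exp_add[symmetric])
    then show ?thesis by simp
  qed
  finally show ?thesis .
qed

text \<open>The total number of rejections is split at \<open>C * n\<close>. Below, stable profiles
  of any shape are unlikely; above, those that are low on some \<open>B\<close> with at least
  \<open>\<delta> * n\<close> students are. Deferred acceptance enters through the stability of its
  profile.\<close>

lemma few_low_ranks:
  fixes \<delta> :: real
  assumes \<delta>: "\<delta> > 0"
  shows "(\<lambda>n. real (card {(pref, prio) \<in> problems n.
        \<delta> * n \<le> card {i \<in> {0..<n}. da_rejections n pref prio i < K}}) / card (problems n))
    \<longlonglongrightarrow> 0"
proof -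
  \<comment> \<open>This size of \<open>C\<close> is what the many-applications bound asks for:
    \<open>K / C <= exp (- 4 / \<delta>)\<close>.\<close>
  obtain C :: nat where C0: "real C > real K * exp (4 / \<delta>)" using reals_Archimedean2 by blast
  have "0 \<le> real K * exp (4 / \<delta>)" by simp
  then have Cpos: "C > 0" using C0 by linarith
  have C: "real K / C \<le> exp (- (4 / \<delta>))"
    using C0 Cpos by (simp add: exp_minus field_simps)
  define a where "a = (\<lambda>n :: nat. exp 3 * (real n + 1) * (real C * n + 1) * exp (2 * real C) *
    exp (- (exp (- (real C + 1)) * n)))"
  define b where "b = (\<lambda>n :: nat. exp 3 * (real n + 1) * (real n * n + 1) * exp (- (2 * real n)))"
  let ?U = "\<lambda>n. {(pref, prio) \<in> problems n.
        \<delta> * n \<le> card {i \<in> {0..<n}. da_rejections n pref prio i < K}}"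
  let ?p = "\<lambda>n. real (card (?U n)) / card (problems n)"
  have bound: "?p n \<le> (real C * n + 1) * a n + real n ^ 2 * (2 ^ n * b n)" if n: "n > 1" for n
  proof -
    let ?I = "{0..<n}" and ?c = "real (card (problems n))"
    let ?V = "\<lambda>m. {(pref, prio) \<in> problems n. \<exists>k. stable_profile n pref prio k \<and>
            (\<Sum>i\<in>?I. k i) = m}"
    let ?W = "\<lambda>m B. {(pref, prio) \<in> problems n. \<exists>k. stable_profile n pref prio k \<and>
            (\<Sum>i\<in>?I. k i) = m \<and> (\<forall>i\<in>B. k i < K)}"
    let ?\<B> = "{B. B \<subseteq> ?I \<and> \<delta> * n \<le> card B}"
    let ?V' = "\<Union>m\<in>{..C * n}. ?V m" and ?W' = "\<Union>m\<in>{C * n<..<n * n}. \<Union>B\<in>?\<B>. ?W m B"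
    have fin\<B>: "finite ?\<B>" by (rule finite_subset[of _ "Pow ?I"]) auto
    have finU: "finite ?V'" "finite ?W'"
      by (rule finite_subset[OF _ finite_problems[of n]]; auto)+
    have "?U n \<subseteq> ?V' \<union> ?W'"
    proof
      fix z assume "z \<in> ?U n"
      then obtain pref prio where z: "z = (pref, prio)" and P: "(pref, prio) \<in> problems n"
        and le: "\<delta> * n \<le> card {i \<in> ?I. da_rejections n pref prio i < K}" by blast
      let ?k = "da_rejections n pref prio"
      let ?B = "{i \<in> ?I. ?k i < K}"
      have st: "stable_profile n pref prio ?k" by (rule da_rejections_stable[OF P])
      have "(\<Sum>i\<in>?I. ?k i) < (\<Sum>i\<in>?I. n)"
        using st n by (intro sum_strict_mono) (auto simp: stable_profile_def)
      then have lt: "(\<Sum>i\<in>?I. ?k i) < n * n" by simp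
      show "z \<in> ?V' \<union> ?W'"
      proof (cases "(\<Sum>i\<in>?I. ?k i) \<le> C * n")
        case True
        then have "z \<in> ?V'" using P st unfolding z by auto
        then show ?thesis by blast
      next
        case False
        have "z \<in> ?W (\<Sum>i\<in>?I. ?k i) ?B" using P st unfolding z by blast
        moreover have "?B \<in> ?\<B>" using le by auto
        moreover have "(\<Sum>i\<in>?I. ?k i) \<in> {C * n<..<n * n}" using False lt by simp
        ultimately show ?thesis by blast
      qed
    qed
    then have "card (?U n) \<le> card (?V' \<union> ?W')" using finU by (intro card_mono finite_UnI)
    also have "\<dots> \<le> card ?V' + card ?W'" by (rule card_Un_le)
    finally have "real (card (?U n)) \<le> real (card ?V' + card ?W')" by (rule of_nat_mono)
    then have "?p n \<le> (real (card ?V') + real (card ?W')) / ?c"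
      by (intro divide_right_mono) (simp_all only: of_nat_add of_nat_0_le_iff)
    also have "\<dots> = real (card ?V') / ?c + real (card ?W') / ?c" by (rule add_divide_distrib)
    also have "real (card ?V') / ?c \<le> real (card {..C * n}) * a n"
    proof (rule card_UN_divide_le)
      show "real (card (?V m)) / ?c \<le> a n" if "m \<in> {..C * n}" for m
        unfolding a_def using that by (intro few_applications_probability_le n) simp
    qed auto
    also have "real (card ?W') / ?c \<le> real (card {C * n<..<n * n}) * (2 ^ n * b n)"
    proof (rule card_UN_divide_le)
      fix m assume m: "m \<in> {C * n<..<n * n}"
      have "real (card (\<Union>B\<in>?\<B>. ?W m B)) / ?c \<le> real (card ?\<B>) * b n"
      proof (rule card_UN_divide_le)
        show "real (card (?W m B)) / ?c \<le> b n" if "B \<in> ?\<B>" for B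
          using many_applications_probability_le[OF n _ _ _ \<delta> Cpos C, of B m] that m
          by (simp add: b_def)
      qed (use fin\<B> in auto)
      also have "card ?\<B> \<le> card (Pow ?I)" by (intro card_mono) auto
      then have "real (card ?\<B>) \<le> 2 ^ n" by (simp add: card_Pow)
      then have "real (card ?\<B>) * b n \<le> 2 ^ n * b n"
        by (intro mult_right_mono) (auto simp: b_def)
      finally show "real (card (\<Union>B\<in>?\<B>. ?W m B)) / ?c \<le> 2 ^ n * b n" .
    qed auto
    also have "real (card {C * n<..<n * n}) * (2 ^ n * b n) \<le> real n ^ 2 * (2 ^ n * b n)"
      by (intro mult_right_mono) (auto simp: b_def power2_eq_square simp flip: of_nat_mult)
    finally show ?thesis by (simp add: add.commute)
  qed
  have la: "(\<lambda>n. (real C * n + 1) * a n) \<longlonglongrightarrow> 0"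
  proof -
    define c where "c = exp (- (real C + 1))"
    define D where "D = real C"
    have "c > 0" "D > 0" using Cpos by (auto simp: c_def D_def)
    then have "(\<lambda>n. (D * real n + 1) * (exp 3 * (real n + 1) * (D * n + 1) * exp (2 * D) *
        exp (- (c * n)))) \<longlonglongrightarrow> 0"
      by real_asymp
    then show ?thesis by (simp add: a_def c_def D_def)
  qed
  have lb: "(\<lambda>n. real n ^ 2 * (2 ^ n * b n)) \<longlonglongrightarrow> 0"
    unfolding b_def by real_asymp
  have upper: "\<forall>\<^sub>F n in sequentially. ?p n \<le> (real C * n + 1) * a n + real n ^ 2 * (2 ^ n * b n)"
    using eventually_gt_at_top[of 1] by eventually_elim (rule bound)
  have lower: "\<forall>\<^sub>F n in sequentially. 0 \<le> ?p n" by simp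
  have "(\<lambda>n. (real C * n + 1) * a n + real n ^ 2 * (2 ^ n * b n)) \<longlonglongrightarrow> 0"
    using tendsto_add[OF la lb] by simp
  then show ?thesis by (rule tendsto_sandwich[OF lower upper tendsto_const])
qed

section \<open>Preferences whose top choices lie in a restricted set of schools\<close>

text \<open>Maclaurin's inequality for the indicator of \<open>T\<close>: \<open>K\<close> distinct
  schools are no likelier to stay in \<open>T\<close> than \<open>K\<close> draws with replacement.
  Then \<open>1 - \<delta> <= exp (- \<delta>)\<close>.\<close>

lemma card_linorders_top_choices_le:
  fixes K :: nat and \<delta> :: real
  assumes n: "n > 0" and K: "K \<le> n" and T: "T \<subseteq> {0..<n}" "real (card T) \<le> (1 - \<delta>) * n"
  shows "real (card {p \<in> linorders n. \<forall>r<K. p r \<in> T}) \<le> fact n * exp (- (\<delta> * K))"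
proof -
  let ?y = "\<lambda>s. if s \<in> T then 1 else 0 :: real"
  have y_prod: "(\<Prod>r<K. ?y (p r)) = (if \<forall>r<K. p r \<in> T then 1 else 0)" for p :: "nat \<Rightarrow> nat"
    by (auto intro: prod.neutral)
  have S: "(\<Sum>t\<in>{0..<n}. ?y (p t)) \<le> card T" if "p \<in> linorders n" for p
  proof -
    have p: "p permutes {0..<n}" using that by (simp add: linorders_def)
    have "(\<Sum>t\<in>{0..<n}. ?y (p t)) = (\<Sum>t\<in>{0..<n}. ?y t)"
      using sum.permute[OF p, of ?y] by (simp add: o_def)
    also have "\<dots> = card ({0..<n} \<inter> T)" by (simp add: sum.If_cases)
    also have "{0..<n} \<inter> T = T" using T by blast
    finally show ?thesis by simp
  qed
  have "real (card {0..<n}) ^ K * (\<Sum>p\<in>linorders n. \<Prod>r<K. ?y (p r))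
      \<le> real (card T) ^ K * real (card (linorders n))"
    by (rule maclaurin_symmetric_family) (use S K in \<open>auto intro: comp_transpose_linorders\<close>)
  also have "(\<Sum>p\<in>linorders n. \<Prod>r<K. ?y (p r)) = card {p \<in> linorders n. \<forall>r<K. p r \<in> T}"
    unfolding y_prod by (simp add: sum.If_cases Int_def)
  finally have *: "real n ^ K * card {p \<in> linorders n. \<forall>r<K. p r \<in> T} \<le> real (card T) ^ K * fact n"
    by (simp add: card_linorders)
  have "real (card T) \<le> n * exp (- \<delta>)"
  proof -
    have "(1 - \<delta>) * n \<le> exp (- \<delta>) * n"
      using exp_ge_add_one_self[of "- \<delta>"] by (intro mult_right_mono) auto
    with T(2) show ?thesis by (simp add: mult.commute)
  qed
  then have "real (card T) ^ K \<le> (n * exp (- \<delta>)) ^ K" by (intro power_mono) auto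
  also have "\<dots> = real n ^ K * exp (- (\<delta> * K))"
    by (simp add: power_mult_distrib exp_of_nat_mult[symmetric] mult.commute)
  finally have "real (card T) ^ K * fact n \<le> real n ^ K * exp (- (\<delta> * K)) * fact n"
    by (intro mult_right_mono) auto
  from order_trans[OF * this] have "real n ^ K * card {p \<in> linorders n. \<forall>r<K. p r \<in> T}
      \<le> real n ^ K * (fact n * exp (- (\<delta> * K)))"
    by (simp only: mult_ac)
  then show ?thesis using n by (simp add: mult_le_cancel_left_pos)
qed

lemma confined_top_choices_probability_le:
  fixes K :: nat and \<delta> :: real
  assumes n: "n > 0" and K: "K \<le> n" and B: "B \<subseteq> {0..<n}"
    and T: "T \<subseteq> {0..<n}" "real (card T) \<le> (1 - \<delta>) * n"
  shows "real (card {(pref, prio) \<in> problems n. \<forall>i\<in>B. \<forall>r<K. pref i r \<in> T}) / card (problems n)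
    \<le> exp (- (\<delta> * K)) ^ card B"
proof -
  let ?I = "{0..<n}"
  let ?Q = "{p \<in> linorders n. \<forall>r<K. p r \<in> T}"
  let ?R = "\<lambda>i. if i \<in> B then ?Q else linorders n"
  have finR: "finite (?R i)" for i by simp
  have "{(pref, prio) \<in> problems n. \<forall>i\<in>B. \<forall>r<K. pref i r \<in> T}
      \<subseteq> PiE ?I ?R \<times> (?I \<rightarrow>\<^sub>E linorders n)" (is "?X \<subseteq> _")
    using B by (auto simp: problems_def PiE_iff extensional_def)
  then have "card ?X \<le> card (PiE ?I ?R \<times> (?I \<rightarrow>\<^sub>E linorders n))"
    by (intro card_mono finite_cartesian_product finite_PiE finR) auto
  also have "\<dots> = (\<Prod>i\<in>?I. card (?R i)) * fact n ^ n"
    by (simp only: card_cartesian_product card_PiE finite_atLeastLessThan card_linorders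
        prod_constant card_atLeastLessThan diff_zero)
  finally have "real (card ?X) \<le> real ((\<Prod>i\<in>?I. card (?R i)) * fact n ^ n)" by (rule of_nat_mono)
  also have "\<dots> = (\<Prod>i\<in>?I. real (card (?R i))) * fact n ^ n" by simp
  also have "\<dots> \<le> (\<Prod>i\<in>?I. fact n * (if i \<in> B then exp (- (\<delta> * K)) else 1)) * fact n ^ n"
    by (intro mult_right_mono prod_mono)
      (use card_linorders_top_choices_le[OF n K T] in \<open>auto simp: card_linorders\<close>)
  also have "\<dots> = fact n ^ n * exp (- (\<delta> * K)) ^ card B * fact n ^ n"
  proof -
    have "?I \<inter> B = B" using B by blast
    then show ?thesis by (simp add: prod.distrib prod.If_cases)
  qed
  finally have "real (card ?X) \<le> (fact n * fact n) ^ n * exp (- (\<delta> * K)) ^ card B"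
    by (simp add: power_mult_distrib mult_ac)
  then show ?thesis by (simp add: card_problems pos_divide_le_eq mult.commute)
qed

text \<open>A union bound over all pairs \<open>B\<close>, \<open>T\<close>, so that it applies to
  sets depending on the problem, such as those derived from an envy-closed set.\<close>

lemma no_confined_top_choices:
  fixes \<delta> \<eta> :: real
  assumes \<delta>: "\<delta> > 0" and \<eta>: "\<eta> > 0"
  obtains K where "(\<lambda>n. real (card {(pref, prio) \<in> problems n. \<exists>B T. B \<subseteq> {0..<n} \<and> T \<subseteq> {0..<n} \<and>
      \<eta> * n \<le> card B \<and> card T \<le> (1 - \<delta>) * n \<and> (\<forall>i\<in>B. \<forall>r<K. pref i r \<in> T)}) / card (problems n))
    \<longlonglongrightarrow> 0"
proof -
  \<comment> \<open>With \<open>\<delta> * K * \<eta> >= 3\<close> a fixed pair has probability at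
    most \<open>exp (- 3 * n)\<close>, against at most \<open>4 ^ n\<close> pairs; and
    \<open>4 < 8 <= exp 3\<close>.\<close>
  obtain K :: nat where K0: "real K > 3 / (\<delta> * \<eta>)" using reals_Archimedean2 by blast
  then have K: "\<delta> * K * \<eta> \<ge> 3" using \<delta> \<eta> by (simp add: field_simps)
  let ?U = "\<lambda>n. {(pref, prio) \<in> problems n. \<exists>B T. B \<subseteq> {0..<n} \<and> T \<subseteq> {0..<n} \<and>
      \<eta> * n \<le> card B \<and> card T \<le> (1 - \<delta>) * n \<and> (\<forall>i\<in>B. \<forall>r<K. pref i r \<in> T)}"
  have bound: "real (card (?U n)) / card (problems n) \<le> 4 ^ n * exp (- (3 * real n))" if n: "n > K" for n
  proof -
    let ?J = "{(B, T). B \<subseteq> {0..<n} \<and> T \<subseteq> {0..<n} \<and> \<eta> * n \<le> card B \<and> card T \<le> (1 - \<delta>) * n}"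
    let ?V = "\<lambda>(B, T). {(pref, prio) \<in> problems n. \<forall>i\<in>B. \<forall>r<K. pref i r \<in> T}"
    have Jsub: "?J \<subseteq> Pow {0..<n} \<times> Pow {0..<n}" by blast
    have finJ: "finite ?J" by (rule finite_subset[OF Jsub]) simp
    have "card ?J \<le> card (Pow {0..<n} \<times> Pow {0..<n})" by (intro card_mono Jsub) simp
    also have "\<dots> = 4 ^ n" by (simp add: card_cartesian_product card_Pow power_mult_distrib[symmetric])
    finally have cardJ: "real (card ?J) \<le> 4 ^ n" by simp
    have eq: "?U n = (\<Union>j\<in>?J. ?V j)" by blast
    have "real (card (\<Union>j\<in>?J. ?V j)) / card (problems n) \<le> real (card ?J) * exp (- (3 * real n))"
    proof (rule card_UN_divide_le[OF finJ])
      fix j assume "j \<in> ?J"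
      then obtain B T where j: "j = (B, T)" "B \<subseteq> {0..<n}" "T \<subseteq> {0..<n}" "\<eta> * n \<le> card B"
        "card T \<le> (1 - \<delta>) * n" by blast
      have "real (card (?V j)) / card (problems n) \<le> exp (- (\<delta> * K)) ^ card B"
        using confined_top_choices_probability_le[of n K B T \<delta>] n j by simp
      also have "\<dots> = exp (- (\<delta> * K * card B))" by (simp add: exp_of_nat_mult[symmetric] mult.commute)
      also have "\<dots> \<le> exp (- (3 * real n))"
      proof -
        have "3 * real n \<le> \<delta> * K * \<eta> * n" using K by (intro mult_right_mono) auto
        also have "\<dots> = \<delta> * K * (\<eta> * n)" by simp
        also have "\<dots> \<le> \<delta> * K * card B" using \<delta> j(4) by (intro mult_left_mono) auto
        finally show ?thesis by simp
      qed
      finally show "real (card (?V j)) / card (problems n) \<le> exp (- (3 * real n))" .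
    qed simp
    also have "\<dots> \<le> 4 ^ n * exp (- (3 * real n))" using cardJ by (intro mult_right_mono) auto
    finally show ?thesis unfolding eq .
  qed
  have upper: "\<forall>\<^sub>F n in sequentially. real (card (?U n)) / card (problems n) \<le> 4 ^ n * exp (- (3 * real n))"
    using eventually_gt_at_top[of K] by eventually_elim (rule bound)
  have lower: "\<forall>\<^sub>F n in sequentially. 0 \<le> real (card (?U n)) / card (problems n)" by simp
  have "4 < exp (3 :: real)"
  proof -
    have "(2 :: real) ^ 3 \<le> exp 1 ^ 3" using exp_ge_add_one_self[of 1] by (intro power_mono) auto
    also have "\<dots> = exp (3 :: real)" by (simp add: exp_of_nat_mult[symmetric])
    finally show ?thesis by simp
  qed
  then have "(\<lambda>n. (4 * exp (- 3)) ^ n) \<longlonglongrightarrow> (0 :: real)"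
    by (intro LIMSEQ_realpow_zero) (auto simp: exp_minus field_simps)
  moreover have "(4 * exp (- 3)) ^ n = 4 ^ n * exp (- (3 * real n))" for n
    by (simp add: power_mult_distrib exp_of_nat_mult[symmetric] mult.commute)
  ultimately have "(\<lambda>n. 4 ^ n * exp (- (3 * real n))) \<longlonglongrightarrow> 0" by simp
  then show ?thesis by (intro that[of K] tendsto_sandwich[OF lower upper tendsto_const])
qed

section \<open>From missing large components to confined choices, and the limit\<close>

text \<open>The deterministic link to the two probabilistic bounds. In a closed set \<open>A\<close>
  of medium size, a student rejected at least \<open>K\<close> times envies the holders of her top
  \<open>K\<close> schools; closure puts them in \<open>A\<close>, so \<open>T\<close> is the set of
  schools held by \<open>A\<close>.\<close>

lemma small_sccs_confine_top_choices:
  fixes \<delta> :: real and K :: nat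
  assumes P: "(pref, prio) \<in> problems n" and n: "n > 0" and \<delta>: "0 < \<delta>" "3 * \<delta> \<le> 1"
    and no: "\<nexists>C. is_scc {0..<n} (envy_edges n pref (DA n pref prio)) C \<and>
      real (card C) \<ge> (1 - 2 * \<delta>) * n"
    and few: "card {i \<in> {0..<n}. da_rejections n pref prio i < K} < \<delta> / 2 * n"
  shows "\<exists>B T. B \<subseteq> {0..<n} \<and> T \<subseteq> {0..<n} \<and> \<delta> / 2 * n \<le> card B \<and>
      card T \<le> (1 - \<delta>) * n \<and> (\<forall>i\<in>B. \<forall>r<K. pref i r \<in> T)"
proof -
  let ?I = "{0..<n}" and ?k = "da_rejections n pref prio" and ?\<mu> = "DA n pref prio"
  let ?E = "envy_edges n pref ?\<mu>"
  have st: "stable_profile n pref prio ?k" by (rule da_rejections_stable[OF P])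
  have bij: "bij_betw ?\<mu> ?I ?I" using stable_profile_bij[OF P st] by (simp add: DA_def[abs_def])
  have E: "?E \<subseteq> ?I \<times> ?I" by (auto simp: envy_edges_def)
  obtain A where A: "A \<subseteq> ?I" "?E `` A \<subseteq> A" "\<delta> * n \<le> card A" "card A \<le> (1 - \<delta>) * n"
    using large_scc_or_medium_closed_set[of ?I ?E \<delta>] E n \<delta> no by auto
  \<comment> \<open>\<open>A\<close> has at least \<open>\<delta> * n\<close> students, of whom
    fewer than \<open>\<delta> / 2 * n\<close> were rejected less than \<open>K\<close>
    times.\<close>
  define B where "B = {i \<in> A. K \<le> ?k i}"
  have finA: "finite A" using A(1) finite_subset by blast
  have "A \<subseteq> B \<union> {i \<in> ?I. ?k i < K}" using A(1) by (auto simp: B_def)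
  then have "card A \<le> card (B \<union> {i \<in> ?I. ?k i < K})"
    using finA by (intro card_mono) (auto simp: B_def)
  also have "\<dots> \<le> card B + card {i \<in> ?I. ?k i < K}" by (rule card_Un_le)
  finally have B: "\<delta> / 2 * n \<le> card B" using few A(3) by (simp add: field_simps)
  have "pref i r \<in> ?\<mu> ` A" if i: "i \<in> B" and r: "r < K" for i r
  proof -
    have i': "i \<in> A" "i < n" "r < ?k i" using i r A(1) by (auto simp: B_def)
    have ki: "?k i < n" using st i' by (simp add: stable_profile_def)
    have p: "pref i permutes ?I" using P i' by (auto simp: problems_def linorders_def PiE_iff)
    have "pref i r \<in> ?I" using permutes_in_image[OF p, of r] i' ki by simp
    \<comment> \<open>The matching is onto, so the school has a holder \<open>j\<close> to be
      envied.\<close>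
    then obtain j where j: "j < n" "?\<mu> j = pref i r"
      using bij unfolding bij_betw_def by (metis atLeastLessThan_iff imageE)
    have "inv (pref i) (?\<mu> j) = r" "inv (pref i) (?\<mu> i) = ?k i"
      using permutes_inverses(2)[OF p] by (simp add: j, simp add: DA_def)
    then have "(i, j) \<in> ?E" using i' j by (simp add: envy_edges_def)
    then have "j \<in> A" using A(2) i' by blast
    then show ?thesis using j by (metis imageI)
  qed
  moreover have "?\<mu> ` A \<subseteq> ?I" using bij A(1) unfolding bij_betw_def by blast
  moreover have "card (?\<mu> ` A) \<le> (1 - \<delta>) * n" using card_image_le[OF finA, of ?\<mu>] A(4) by linarith
  moreover have "B \<subseteq> ?I" using A(1) by (auto simp: B_def)
  ultimately show ?thesis using B by blast
qed

theorem theorem1: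
  fixes \<epsilon> :: real
  assumes "\<epsilon> > 0"
  shows "(\<lambda>n. real (card {(pref, prio) \<in> problems n.
            \<exists>C. is_scc {0..<n} (envy_edges n pref (DA n pref prio)) C \<and>
                real (card C) \<ge> (1 - \<epsilon>) * real n})
          / real (card (problems n))) \<longlonglongrightarrow> 1"
proof -
  \<comment> \<open>Capping at 1 secures \<open>3 * \<delta> <= 1\<close> for large
    \<open>\<epsilon>\<close> too, and \<open>2 * \<delta> <= \<epsilon>\<close> makes a component
    of size \<open>(1 - 2 * \<delta>) * n\<close> large enough.\<close>
  define \<delta> where "\<delta> = min \<epsilon> 1 / 3"
  have \<delta>: "0 < \<delta>" "3 * \<delta> \<le> 1" "2 * \<delta> \<le> \<epsilon>" using assms by (auto simp: \<delta>_def)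
  have \<delta>2: "\<delta> / 2 > 0" using \<delta> by simp
  let ?b = "\<lambda>K n. {(pref, prio) \<in> problems n. \<exists>B T. B \<subseteq> {0..<n} \<and> T \<subseteq> {0..<n} \<and>
      \<delta> / 2 * n \<le> card B \<and> card T \<le> (1 - \<delta>) * n \<and> (\<forall>i\<in>B. \<forall>r<K. pref i r \<in> T)}"
  \<comment> \<open>\<open>K\<close> is fixed by the confinement bound; the low-rank bound below
    holds for every \<open>K\<close> and is taken at this one.\<close>
  obtain K where lb: "(\<lambda>n. real (card (?b K n)) / card (problems n)) \<longlonglongrightarrow> 0"
    by (rule no_confined_top_choices[OF \<delta>(1) \<delta>2])
  let ?a = "\<lambda>n. {(pref, prio) \<in> problems n.
        \<delta> / 2 * n \<le> card {i \<in> {0..<n}. da_rejections n pref prio i < K}}"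
  have la: "(\<lambda>n. real (card (?a n)) / card (problems n)) \<longlonglongrightarrow> 0"
    by (rule few_low_ranks[OF \<delta>2])
  let ?g = "\<lambda>n. {(pref, prio) \<in> problems n.
            \<exists>C. is_scc {0..<n} (envy_edges n pref (DA n pref prio)) C \<and>
                real (card C) \<ge> (1 - \<epsilon>) * real n}"
  let ?p = "\<lambda>S n. real (card (S n)) / real (card (problems n))"
  have pos: "real (card (problems n)) > 0" for n by (simp add: card_problems)
  have "1 - (?p ?a n + ?p (?b K) n) \<le> ?p ?g n" if n: "n > 0" for n
  proof -
    have "problems n \<subseteq> ?g n \<union> (?a n \<union> ?b K n)"
    proof
      fix z assume z: "z \<in> problems n"
      obtain pref prio where zz: "z = (pref, prio)" by (cases z)
      have P: "(pref, prio) \<in> problems n" using z zz by simp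
      show "z \<in> ?g n \<union> (?a n \<union> ?b K n)"
      proof (rule ccontr)
        assume neg: "z \<notin> ?g n \<union> (?a n \<union> ?b K n)"
        have le: "(1 - \<epsilon>) * real n \<le> (1 - 2 * \<delta>) * n" using \<delta> by (intro mult_right_mono) auto
        have "\<nexists>C. is_scc {0..<n} (envy_edges n pref (DA n pref prio)) C \<and>
            real (card C) \<ge> (1 - 2 * \<delta>) * n"
          using neg le P unfolding zz by (blast intro: order_trans)
        moreover have "card {i \<in> {0..<n}. da_rejections n pref prio i < K} < \<delta> / 2 * n"
          using neg P unfolding zz by (simp add: not_le)
        ultimately have "z \<in> ?b K n"
          using small_sccs_confine_top_choices[OF P n \<delta>(1,2)] P unfolding zz by blast
        with neg show False by blast
      qed
    qed
    moreover have fin: "finite (?g n)" "finite (?a n)" "finite (?b K n)"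
      by (rule finite_subset[OF _ finite_problems[of n]]; blast)+
    ultimately have "card (problems n) \<le> card (?g n \<union> (?a n \<union> ?b K n))"
      by (intro card_mono finite_UnI)
    also have "\<dots> \<le> card (?g n) + (card (?a n) + card (?b K n))"
      by (rule order_trans[OF card_Un_le add_left_mono[OF card_Un_le]])
    finally have "real (card (problems n)) \<le> real (card (?g n) + (card (?a n) + card (?b K n)))"
      by (rule of_nat_mono)
    then have "real (card (problems n)) / real (card (problems n))
        \<le> (real (card (?g n)) + (real (card (?a n)) + real (card (?b K n)))) / real (card (problems n))"
      by (intro divide_right_mono) (simp_all only: of_nat_add of_nat_0_le_iff)
    moreover have "real (card (problems n)) / real (card (problems n)) = 1"
      using pos[of n] by (intro divide_self) linarith
    ultimately have "1 \<le> ?p ?g n + (?p ?a n + ?p (?b K) n)"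
      by (simp only: add_divide_distrib)
    then show ?thesis by linarith
  qed
  then have lower: "\<forall>\<^sub>F n in sequentially. 1 - (?p ?a n + ?p (?b K) n) \<le> ?p ?g n"
    using eventually_gt_at_top[of 0] by (rule eventually_mono[rotated])
  have "card (?g n) \<le> card (problems n)" for n by (intro card_mono) auto
  then have upper: "\<forall>\<^sub>F n in sequentially. ?p ?g n \<le> 1"
    using pos by (simp add: pos_divide_le_eq)
  have "(\<lambda>n. 1 - (?p ?a n + ?p (?b K) n)) \<longlonglongrightarrow> 1 - (0 + 0)"
    by (intro tendsto_diff tendsto_const tendsto_add la lb)
  then have "(\<lambda>n. 1 - (?p ?a n + ?p (?b K) n)) \<longlonglongrightarrow> 1" by simp
  then show ?thesis by (rule tendsto_sandwich[OF lower upper _ tendsto_const])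
qed

end
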